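(* For each $K\ge1$ there exist a compact set $E\subset\mathbb{C}$ with $\dim_H E=0$ and a $K$-quasiconformal mapping $g:\mathbb{C}\to\mathbb{C}$ so that $$\frac1{\overline{\dim}_\theta g(E)}-\frac12=\frac1K\left(\frac1{\overline{\dim}_\theta E}-\frac12\right)\qquad\text{for all }0<\theta\le1.$$
   Context: $\dim_H$ is Hausdorff dimension and $\mathbb{C}$ is identified with $\mathbb{R}^2$. For a bounded set $A\subset\mathbb{R}^2$ and $0<\theta<1$, the upper $\theta$-intermediate dimension $\overline{\dim}_\theta A$ is the infimum of those $s>0$ such that for each $\epsilon>0$ there exists $\delta_0>0$ so that for each $0<\delta\le\delta_0$ there is a countable covering $(A_i)$ of $A$ by subsets of $\mathbb{R}^2$ with $\delta^{1/\theta}\le\operatorname{diam}(A_i)\le\delta$ for all $i$ and $\sum_i(\operatorname{diam}A_i)^s<\epsilon$. For $\theta=1$, $\overline{\dim}_1A:=\overline{\dim}_BA=\limsup_{r\to0}\frac{\log N(A,r)}{-\log r}$ is the upper box-counting dimension, where $N(A,r)$ is the minimal number of sets of diameter $r$ needed to cover $A$. The displayed identity is understood as an identity between real numbers; in particular all the dimensions appearing in denominators are positive. A homeomorphism $g:\mathbb{C}\to\mathbb{C}$ is $K$-quasiconformal if $g\in W^{1,2}_{loc}$ and $\|Dg(x)\|^2\le K\det Dg(x)$ for a.e. $x$ (operator norm). *)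

theory Defs
  imports "HOL-Analysis.Analysis"
begin

text \<open>
  The library's \<^const>\<open>diameter\<close> is only meaningful on bounded sets, so members of coverings are
  always required to be bounded. Since all terms are nonnegative, the sums are taken in
  \<^typ>\<open>ennreal\<close>, where every infinite sum exists.
\<close>

definition cover_sum :: "real \<Rightarrow> 'a::euclidean_space set set \<Rightarrow> ennreal" where
  "cover_sum s \<C> = (\<Sum>\<^sub>\<infinity>U\<in>\<C>. ennreal (diameter U powr s))"

definition hausdorff_premeasure :: "real \<Rightarrow> real \<Rightarrow> 'a::euclidean_space set \<Rightarrow> ennreal" where
  "hausdorff_premeasure \<delta> s A =
     Inf {cover_sum s \<C> | \<C>. countable \<C> \<and> A \<subseteq> \<Union>\<C> \<and> (\<forall>U\<in>\<C>. bounded U \<and> diameter U \<le> \<delta>)}"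

definition hausdorff_measure :: "real \<Rightarrow> 'a::euclidean_space set \<Rightarrow> ennreal" where
  "hausdorff_measure s A = (SUP \<delta>\<in>{0<..}. hausdorff_premeasure \<delta> s A)"

text \<open>
  Restricting to \<open>s > 0\<close> does not change the infimum and avoids the convention for \<open>0\<close> to the
  power \<open>0\<close>. The infimum is over a nonempty set, as every \<open>s\<close> above the dimension of the ambient
  space belongs to it.
\<close>

definition hausdorff_dim :: "'a::euclidean_space set \<Rightarrow> real" where
  "hausdorff_dim A = Inf {s. 0 < s \<and> hausdorff_measure s A = 0}"

text \<open>The following notions are meant for bounded \<open>A\<close>.\<close>

definition covering_number :: "'a::euclidean_space set \<Rightarrow> real \<Rightarrow> nat" where
  "covering_number A r =
     (LEAST n. \<exists>\<C>. finite \<C> \<and> card \<C> = n \<and> A \<subseteq> \<Union>\<C> \<and> (\<forall>U\<in>\<C>. bounded U \<and> diameter U = r))"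

definition upper_box_dim :: "'a::euclidean_space set \<Rightarrow> real" where
  "upper_box_dim A =
     real_of_ereal (Limsup (at_right 0) (\<lambda>r. ereal (ln (real (covering_number A r)) / - ln r)))"

text \<open>
  Coverings are countable collections, finite ones included: for bounded \<open>A\<close> the lower bound on the
  diameters forces every covering with finite sum to be finite.
\<close>

definition upper_intermediate_dim :: "real \<Rightarrow> 'a::euclidean_space set \<Rightarrow> real" where
  "upper_intermediate_dim \<theta> A =
     (if \<theta> = 1 then upper_box_dim A
      else Inf {s. 0 < s \<and>
        (\<forall>\<epsilon>>0. \<exists>\<delta>\<^sub>0>0. \<forall>\<delta>. 0 < \<delta> \<and> \<delta> \<le> \<delta>\<^sub>0 \<longrightarrow>
          (\<exists>\<C>. countable \<C> \<and> A \<subseteq> \<Union>\<C> \<and>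
               (\<forall>U\<in>\<C>. bounded U \<and> \<delta> powr (1 / \<theta>) \<le> diameter U \<and> diameter U \<le> \<delta>) \<and>
               cover_sum s \<C> < ennreal \<epsilon>))})"

fun times_cont_diff :: "nat \<Rightarrow> ('a::euclidean_space \<Rightarrow> real) \<Rightarrow> bool" where
  "times_cont_diff 0 f \<longleftrightarrow> continuous_on UNIV f"
| "times_cont_diff (Suc n) f \<longleftrightarrow>
     f differentiable_on UNIV \<and> (\<forall>v. times_cont_diff n (\<lambda>x. frechet_derivative f (at x) v))"

definition test_function :: "('a::euclidean_space \<Rightarrow> real) \<Rightarrow> bool" where
  "test_function \<phi> \<longleftrightarrow> (\<forall>n. times_cont_diff n \<phi>) \<and> compact (closure {x. \<phi> x \<noteq> 0})"

definition L2_loc :: "('a::euclidean_space \<Rightarrow> 'b::euclidean_space) \<Rightarrow> bool" where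
  "L2_loc f \<longleftrightarrow> f \<in> borel_measurable lebesgue \<and>
     (\<forall>S. compact S \<longrightarrow> set_integrable lebesgue S (\<lambda>x. (norm (f x))\<^sup>2))"

text \<open>
  \<open>f\<close> lies in the local Sobolev space \<open>W\<close> with exponents \<open>1,2\<close>, and \<open>D\<close> represents its weak
  differential: \<open>D x e\<close>, for \<open>e\<close> in the basis, are the weak partial derivatives. Local square
  integrability makes all integrals below exist.
\<close>

definition W12_loc_with_differential ::
  "('a::euclidean_space \<Rightarrow> 'b::euclidean_space) \<Rightarrow> ('a \<Rightarrow> 'a \<Rightarrow>\<^sub>L 'b) \<Rightarrow> bool" where
  "W12_loc_with_differential f D \<longleftrightarrow> L2_loc f \<and>
     (\<forall>e\<in>Basis. L2_loc (\<lambda>x. blinfun_apply (D x) e) \<and>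
        (\<forall>\<phi>. test_function \<phi> \<longrightarrow>
           (LINT x|lebesgue. frechet_derivative \<phi> (at x) e *\<^sub>R f x) =
           - (LINT x|lebesgue. \<phi> x *\<^sub>R blinfun_apply (D x) e)))"

text \<open>The determinant of a real-linear endomorphism of the plane, in the real basis \<open>1, \<i>\<close>.\<close>

definition det_real_linear :: "(complex \<Rightarrow>\<^sub>L complex) \<Rightarrow> real" where
  "det_real_linear L =
     det (vector [vector [Re (blinfun_apply L 1), Re (blinfun_apply L \<i>)],
                  vector [Im (blinfun_apply L 1), Im (blinfun_apply L \<i>)]] :: real^2^2)"

text \<open>The weak differential is unique up to null sets, so the choice of \<open>D\<close> is immaterial.\<close>

definition quasiconformal :: "real \<Rightarrow> (complex \<Rightarrow> complex) \<Rightarrow> bool" where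
  "quasiconformal K g \<longleftrightarrow>
     (\<exists>h. homeomorphism UNIV UNIV g h) \<and>
     (\<exists>D. W12_loc_with_differential g D \<and>
          (AE x in lebesgue. (norm (D x))\<^sup>2 \<le> K * det_real_linear (D x)))"

end

theory Submission
  imports Defs
begin

text \<open>
  The radial stretch \<open>z \<mapsto> |z|\<^sup>a\<^sup>-\<^sup>1 z\<close> multiplies exponents, so it maps the countable set \<open>E\<^sub>p\<close>, the image
  of the Gaussian integers under \<open>z \<mapsto> |z|\<^sup>-\<^sup>p\<^sup>-\<^sup>1 z\<close>, to \<open>E\<^sub>a\<^sub>p\<close>; for \<open>a = 1/K\<close> it is \<open>K\<close>-quasiconformal.
  Covering the lattice points of modulus at most \<open>N\<close> individually and the remaining disc of radius
  \<open>N\<^sup>-\<^sup>p\<close> uniformly, with \<open>N\<close> chosen optimally, and testing against counting measure for the lower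
  bound, the \<open>\<theta>\<close>-intermediate dimension of \<open>E\<^sub>p\<close> is \<open>2\<theta>/(p + \<theta>)\<close>. Hence \<open>1/dim - 1/2 = p/(2\<theta>)\<close> is
  linear in \<open>p\<close>, and \<open>E = E\<^sub>1\<close> works.
\<close>

section \<open>Radial stretches and the Gaussian integers\<close>

text \<open>The required identity has the same factor 1/K for every \<theta>, so a single map must
  be extremal for all the dimensions at once. A radial stretch with exponent a = 1/K qualifies: away
  from the origin its differential scales by \<open>|z|^(a-1)\<close> tangentially and by a times
  that radially, so the distortion is K at every point. Countability forces Hausdorff dimension 0,
  while coverings with a lower bound on the diameters still see how the points accumulate at the
  origin.

  The lower bound for the dimension rests on spacing: images of lattice points of modulus of order N
  are at least a multiple of N^(-p-1) apart, so a set of diameter d contains at most a multiple of 1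
  + d^2 N^(2p+2) of them. The exponent 2\<theta>/(p + \<theta>) is the one for which this is at most
  a multiple of N^2 d^s over the whole admissible range of d.

  The analytic obstacle is the origin, where the differential is unbounded for K > 1. The weak
  differential is therefore obtained as a limit of smooth approximations.\<close>

definition stretch :: "real \<Rightarrow> complex \<Rightarrow> complex" where
  "stretch a z = norm z powr (a - 1) *\<^sub>R z"

lemma stretch_0 [simp]: "stretch a 0 = 0"
  by (simp add: stretch_def)

lemma stretch_1 [simp]: "stretch 1 z = z"
  by (cases "z = 0") (auto simp: stretch_def)

lemma norm_stretch: "norm (stretch a z) = norm z powr a"
proof (cases "z = 0")
  case False
  then have "norm z powr (a - 1) * norm z = norm z powr (a - 1) * norm z powr 1"
    by simp
  also have "\<dots> = norm z powr a"
    unfolding powr_add [symmetric] by simp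
  finally show ?thesis by (simp add: stretch_def)
qed simp

lemma stretch_stretch: "stretch a (stretch b z) = stretch (a * b) z"
proof (cases "z = 0")
  case False
  have "stretch a (stretch b z) = ((norm z powr b) powr (a - 1) * norm z powr (b - 1)) *\<^sub>R z"
    unfolding stretch_def [of a] norm_stretch by (simp add: stretch_def)
  also have "(norm z powr b) powr (a - 1) * norm z powr (b - 1) = norm z powr (a * b - 1)"
    unfolding powr_powr powr_add [symmetric] by (simp add: algebra_simps)
  finally show ?thesis by (simp add: stretch_def)
qed simp

section \<open>Spacing of points under stretches with negative exponent\<close>

text \<open>The slope of \<open>t powr (- p)\<close> decreases in modulus as t grows, so by the mean
  value theorem its size at M is a lower bound on (0, M]. This is the radial half of the spacing
  estimate.\<close>

lemma powr_minus_diff_ge: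
  fixes r t p M :: real
  assumes "0 < r" "r \<le> t" "t \<le> M" "0 < p"
  shows "p * M powr (- p - 1) * (t - r) \<le> r powr (- p) - t powr (- p)"
proof (cases "r = t")
  case False
  then have "r < t" using assms by simp
  have "\<exists>z>r. z < t \<and> t powr (- p) - r powr (- p) = (t - r) * (- p * z powr (- p - 1))"
    using \<open>r < t\<close> assms by (intro MVT2) (auto intro!: derivative_eq_intros)
  then obtain z where z: "r < z" "z < t"
    "t powr (- p) - r powr (- p) = (t - r) * (- p * z powr (- p - 1))" by blast
  have "M powr (- p - 1) \<le> z powr (- p - 1)"
    using z assms by (intro powr_mono2') auto
  then have "p * M powr (- p - 1) * (t - r) \<le> p * z powr (- p - 1) * (t - r)"
    using assms by (intro mult_right_mono mult_left_mono) auto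
  with z(3) show ?thesis by (simp add: algebra_simps)
qed simp

text \<open>Separates the radial from the angular contribution. For nonnegative factors the last
  summand is nonnegative by Cauchy-Schwarz, so two rescalings of the same pair can be compared
  summand by summand.\<close>

lemma norm_scaled_diff_sq:
  fixes z w :: "'a::real_inner"
  shows "(norm (x *\<^sub>R z - y *\<^sub>R w))\<^sup>2 =
    (x * norm z - y * norm w)\<^sup>2 + 2 * (x * y) * (norm z * norm w - z \<bullet> w)"
  by (simp only: power2_norm_eq_inner power2_diff power_mult_distrib)
    (simp add: inner_diff inner_commute power2_eq_square algebra_simps)

text \<open>The map scales by \<open>norm v powr (- p - 1)\<close> tangentially and by p times that
  radially; \<open>min 1 p\<close> serves both directions, and the weight is smallest at modulus M.
  Comparing squared distances yields the bound globally, which a lower bound on the differential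
  alone would not.\<close>

lemma stretch_expansion:
  assumes "z \<noteq> 0" "w \<noteq> 0" "norm z \<le> M" "norm w \<le> M" "0 < p"
  shows "min 1 p * M powr (- p - 1) * dist z w \<le> dist (stretch (- p) z) (stretch (- p) w)"
proof -
  define m where "m = min 1 p * M powr (- p - 1)"
  have "m \<ge> 0" using assms by (simp add: m_def)
  have pow: "M powr (- p - 1) \<le> norm v powr (- p - 1)" if "v \<in> {z, w}" for v
    using that assms by (intro powr_mono2') auto
  have le: "m \<le> M powr (- p - 1)" "m \<le> p * M powr (- p - 1)"
    unfolding m_def by (simp_all add: mult_left_le_one_le mult_right_mono assms less_imp_le)
  have rad: "(m * (norm z - norm w))\<^sup>2 \<le> (norm z powr (- p) - norm w powr (- p))\<^sup>2"
  proof -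
    have "m * \<bar>norm z - norm w\<bar> \<le> p * M powr (- p - 1) * \<bar>norm z - norm w\<bar>"
      using le by (intro mult_right_mono) auto
    also have "\<dots> \<le> \<bar>norm z powr (- p) - norm w powr (- p)\<bar>"
      using powr_minus_diff_ge [of "norm z" "norm w" M p]
        powr_minus_diff_ge [of "norm w" "norm z" M p] assms
      by (cases "norm z \<le> norm w") auto
    finally show ?thesis using \<open>m \<ge> 0\<close>
      by (intro abs_le_square_iff [THEN iffD1]) (simp add: abs_mult)
  qed
  have ang: "m\<^sup>2 * (norm z * norm w - z \<bullet> w) \<le>
      norm z powr (- p - 1) * norm w powr (- p - 1) * (norm z * norm w - z \<bullet> w)"
    unfolding power2_eq_square using le(1) pow \<open>m \<ge> 0\<close>
    by (intro mult_right_mono mult_mono) (auto intro: order_trans simp: norm_cauchy_schwarz)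
  have "(m * dist z w)\<^sup>2 =
      (m * (norm z - norm w))\<^sup>2 + 2 * (m\<^sup>2 * (norm z * norm w - z \<bullet> w))"
    using norm_scaled_diff_sq [of 1 z 1 w] unfolding dist_norm power_mult_distrib
    by simp (simp only: algebra_simps)
  also have "\<dots> \<le> (norm z powr (- p) - norm w powr (- p))\<^sup>2 +
      2 * (norm z powr (- p - 1) * norm w powr (- p - 1) * (norm z * norm w - z \<bullet> w))"
    using rad ang by linarith
  also have "\<dots> = (dist (stretch (- p) z) (stretch (- p) w))\<^sup>2"
    using norm_stretch [of "- p" z] norm_stretch [of "- p" w]
    by (simp add: dist_norm stretch_def norm_scaled_diff_sq)
  finally show ?thesis
    unfolding m_def [symmetric] by (rule power2_le_imp_le) simp
qed

section \<open>Counting lattice points, separated points and covering discs\<close>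

definition gaussian_ints :: "complex set" where
  "gaussian_ints = range (\<lambda>(i::int, j::int). Complex (of_int i) (of_int j))"

lemma countable_gaussian_ints [simp]: "countable gaussian_ints"
  by (simp add: gaussian_ints_def)

text \<open>Used twice: to count lattice points in a disc, and to count the centres of a rescaled
  grid that covers a disc.\<close>

lemma card_gaussian_box_le:
  assumes "0 \<le> x"
  defines "S \<equiv> (\<lambda>(i, j). Complex (of_int i) (of_int j)) ` ({- \<lfloor>x\<rfloor>..\<lfloor>x\<rfloor>} \<times> {- \<lfloor>x\<rfloor>..\<lfloor>x\<rfloor>})"
  shows "finite S" "real (card S) \<le> (2 * x + 1)\<^sup>2"
proof -
  show "finite S" by (simp add: S_def)
  have "card S \<le> card ({- \<lfloor>x\<rfloor>..\<lfloor>x\<rfloor>} \<times> {- \<lfloor>x\<rfloor>..\<lfloor>x\<rfloor>})"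
    unfolding S_def by (intro card_image_le) simp
  then have "real (card S) \<le> (real (nat (2 * \<lfloor>x\<rfloor> + 1)))\<^sup>2"
    unfolding card_cartesian_product card_atLeastAtMost_int power2_eq_square
      of_nat_mult [symmetric] of_nat_le_iff by (simp add: algebra_simps)
  also have "\<dots> \<le> (2 * x + 1)\<^sup>2"
    using assms by (intro power_mono) linarith+
  finally show "real (card S) \<le> (2 * x + 1)\<^sup>2" .
qed

lemma gaussian_ints_norm_le:
  assumes "0 \<le> x"
  shows "finite {z \<in> gaussian_ints. norm z \<le> x}"
    and "real (card {z \<in> gaussian_ints. norm z \<le> x}) \<le> (2 * x + 1)\<^sup>2"
proof -
  define S where
    "S = (\<lambda>(i, j). Complex (of_int i) (of_int j)) ` ({- \<lfloor>x\<rfloor>..\<lfloor>x\<rfloor>} \<times> {- \<lfloor>x\<rfloor>..\<lfloor>x\<rfloor>})"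
  note S = card_gaussian_box_le [OF assms, folded S_def]
  have sub: "{z \<in> gaussian_ints. norm z \<le> x} \<subseteq> S"
  proof clarify
    fix z assume "z \<in> gaussian_ints" "norm z \<le> x"
    then obtain i j where z: "z = Complex (of_int i) (of_int j)"
      by (auto simp: gaussian_ints_def)
    have "\<bar>of_int i\<bar> \<le> x" "\<bar>of_int j\<bar> \<le> x"
      using abs_Re_le_cmod [of z] abs_Im_le_cmod [of z] \<open>norm z \<le> x\<close> by (auto simp: z)
    then have "(i, j) \<in> {- \<lfloor>x\<rfloor>..\<lfloor>x\<rfloor>} \<times> {- \<lfloor>x\<rfloor>..\<lfloor>x\<rfloor>}" by simp linarith
    then show "z \<in> S" by (force simp: S_def z)
  qed
  then show "finite {z \<in> gaussian_ints. norm z \<le> x}"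
    using S(1) finite_subset by blast
  have "card {z \<in> gaussian_ints. norm z \<le> x} \<le> card S"
    by (intro card_mono S sub)
  then show "real (card {z \<in> gaussian_ints. norm z \<le> x}) \<le> (2 * x + 1)\<^sup>2"
    using S(2) by linarith
qed

lemma gaussian_ints_dist_ge:
  assumes "z \<in> gaussian_ints" "w \<in> gaussian_ints" "z \<noteq> w"
  shows "1 \<le> dist z w"
proof -
  obtain i j k l where "z = Complex (of_int i) (of_int j)" "w = Complex (of_int k) (of_int l)"
    using assms by (auto simp: gaussian_ints_def)
  then have *: "Re (z - w) = of_int (i - k)" "Im (z - w) = of_int (j - l)" "i \<noteq> k \<or> j \<noteq> l"
    using assms by auto
  have "1 \<le> \<bar>Re (z - w)\<bar> \<or> 1 \<le> \<bar>Im (z - w)\<bar>"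
    unfolding * using *(3) by linarith
  then show ?thesis
    using abs_Re_le_cmod [of "z - w"] abs_Im_le_cmod [of "z - w"] by (auto simp: dist_norm)
qed

text \<open>Pigeonhole on a grid of cells of side \<sigma>/2: two points in one cell differ by less
  than \<sigma>/2 in each coordinate, hence are less than \<sigma> apart. Each coordinate ranges
  over an interval of length 2d, which meets at most 4d/\<sigma> + 2 cells.\<close>

lemma card_separated_le:
  fixes S :: "complex set"
  assumes sep: "\<And>x y. x \<in> S \<Longrightarrow> y \<in> S \<Longrightarrow> x \<noteq> y \<Longrightarrow> \<sigma> \<le> dist x y"
    and bd: "\<And>x y. x \<in> S \<Longrightarrow> y \<in> S \<Longrightarrow> dist x y \<le> d"
    and "0 < \<sigma>" "0 \<le> d"
  shows "real (card S) \<le> (4 * d / \<sigma> + 2)\<^sup>2"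
proof (cases "S = {}")
  case True
  then show ?thesis by simp
next
  case False
  then obtain c where c: "c \<in> S" by blast
  define f where "f x = (\<lfloor>2 * Re x / \<sigma>\<rfloor>, \<lfloor>2 * Im x / \<sigma>\<rfloor>)" for x
  define I where "I t = {\<lfloor>2 * (t - d) / \<sigma>\<rfloor>..\<lfloor>2 * (t + d) / \<sigma>\<rfloor>}" for t
  have close: "\<bar>x - y\<bar> < \<sigma> / 2" if "\<lfloor>2 * x / \<sigma>\<rfloor> = \<lfloor>2 * y / \<sigma>\<rfloor>" for x y :: real
  proof -
    have "\<bar>2 * x / \<sigma> - 2 * y / \<sigma>\<bar> < 1" using that by linarith
    then have "\<bar>2 * (x - y)\<bar> / \<bar>\<sigma>\<bar> < 1"
      unfolding abs_divide [symmetric] by (simp add: diff_divide_distrib right_diff_distrib)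
    then have "\<bar>2 * (x - y)\<bar> < \<sigma>" using \<open>0 < \<sigma>\<close> by (simp add: divide_less_eq)
    then show ?thesis by (simp add: abs_if split: if_splits)
  qed
  have inj: "inj_on f S"
  proof (rule inj_onI, rule ccontr)
    fix x y assume xy: "x \<in> S" "y \<in> S" "f x = f y" "x \<noteq> y"
    have "dist x y \<le> \<bar>Re x - Re y\<bar> + \<bar>Im x - Im y\<bar>"
      using cmod_le [of "x - y"] by (simp add: dist_norm)
    also have "\<dots> < \<sigma>" using close [of "Re x" "Re y"] close [of "Im x" "Im y"] xy(3)
      by (simp add: f_def)
    finally show False using sep [of x y] xy by simp
  qed
  have sub: "f ` S \<subseteq> I (Re c) \<times> I (Im c)"
  proof (rule image_subsetI)
    fix x assume "x \<in> S"
    then have "dist x c \<le> d" using bd c by blast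
    then have "\<bar>Re x - Re c\<bar> \<le> d" "\<bar>Im x - Im c\<bar> \<le> d"
      using abs_Re_le_cmod [of "x - c"] abs_Im_le_cmod [of "x - c"] by (auto simp: dist_norm)
    then show "f x \<in> I (Re c) \<times> I (Im c)" using \<open>0 < \<sigma>\<close>
      by (auto simp: f_def I_def intro!: floor_mono divide_right_mono)
  qed
  have cardI: "real (card (I t)) \<le> 4 * d / \<sigma> + 2" for t
  proof -
    have "2 * (t + d) / \<sigma> - 2 * (t - d) / \<sigma> = 4 * d / \<sigma>"
      using \<open>0 < \<sigma>\<close> by (simp add: field_simps)
    moreover have "0 \<le> 4 * d / \<sigma>" using assms by simp
    ultimately show ?thesis unfolding I_def card_atLeastAtMost_int by linarith
  qed
  have "card S = card (f ` S)" using inj by (simp add: card_image)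
  also have "\<dots> \<le> card (I (Re c) \<times> I (Im c))"
    by (intro card_mono sub) (simp add: I_def)
  finally have "real (card S) \<le> real (card (I (Re c))) * real (card (I (Im c)))"
    by (simp add: card_cartesian_product flip: of_nat_mult)
  also have "\<dots> \<le> (4 * d / \<sigma> + 2) * (4 * d / \<sigma> + 2)"
    using cardI assms by (intro mult_mono) auto
  finally show ?thesis by (simp add: power2_eq_square)
qed

lemma card_cover_ball:
  fixes R \<delta> :: real
  assumes "0 < \<delta>" "0 \<le> R"
  obtains P :: "complex set" where "finite P" "real (card P) \<le> (8 * R / \<delta> + 3)\<^sup>2"
    "cball 0 R \<subseteq> (\<Union>c\<in>P. cball c (\<delta> / 2))"
proof -
  \<comment> \<open>Rounding down on a grid of mesh \<open>h\<close> moves each coordinate by at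
    most \<open>h\<close>, so the point moves by at most \<open>2 * h\<close>, the required radius
    \<delta>/2.\<close>
  define h where "h = \<delta> / 4"
  have "h > 0" using assms by (simp add: h_def)
  \<comment> \<open>The extra 1 is for negative coordinates, whose floor can exceed
    \<open>R / h\<close> in modulus.\<close>
  define x where "x = R / h + 1"
  have "x \<ge> 0" using assms \<open>h > 0\<close> by (simp add: x_def)
  define S where
    "S = (\<lambda>(i, j). Complex (of_int i) (of_int j)) ` ({- \<lfloor>x\<rfloor>..\<lfloor>x\<rfloor>} \<times> {- \<lfloor>x\<rfloor>..\<lfloor>x\<rfloor>})"
  note S = card_gaussian_box_le [OF \<open>x \<ge> 0\<close>, folded S_def]
  show ?thesis
  proof (rule that [of "(\<lambda>z. h *\<^sub>R z) ` S"])
    have "real (card ((\<lambda>z. h *\<^sub>R z) ` S)) \<le> real (card S)"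
      using card_image_le [OF S(1)] by simp
    also note S(2)
    also have "2 * x + 1 = 8 * R / \<delta> + 3" using assms by (simp add: x_def h_def)
    finally show "real (card ((\<lambda>z. h *\<^sub>R z) ` S)) \<le> (8 * R / \<delta> + 3)\<^sup>2" .
    show "cball 0 R \<subseteq> (\<Union>c\<in>(\<lambda>z. h *\<^sub>R z) ` S. cball c (\<delta> / 2))"
    proof
      fix z :: complex assume "z \<in> cball 0 R"
      then have R: "\<bar>Re z\<bar> \<le> R" "\<bar>Im z\<bar> \<le> R"
        using abs_Re_le_cmod [of z] abs_Im_le_cmod [of z] by auto
      have rnd: "\<bar>\<lfloor>t / h\<rfloor>\<bar> \<le> \<lfloor>x\<rfloor>" if "\<bar>t\<bar> \<le> R" for t
      proof -
        have "\<bar>t / h\<bar> \<le> R / h" using that \<open>h > 0\<close> by (simp add: abs_divide divide_right_mono)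
        then show ?thesis unfolding x_def by linarith
      qed
      have err: "\<bar>h * of_int \<lfloor>t / h\<rfloor> - t\<bar> \<le> h" for t
      proof -
        have "t = h * (t / h)" using \<open>h > 0\<close> by simp
        then have "\<bar>h * of_int \<lfloor>t / h\<rfloor> - t\<bar> = \<bar>h * (of_int \<lfloor>t / h\<rfloor> - t / h)\<bar>"
          by (metis right_diff_distrib)
        also have "\<dots> = h * \<bar>of_int \<lfloor>t / h\<rfloor> - t / h\<bar>"
          using \<open>h > 0\<close> by (simp only: abs_mult abs_of_pos)
        also have "\<bar>of_int \<lfloor>t / h\<rfloor> - t / h\<bar> \<le> 1" by linarith
        finally show ?thesis using \<open>h > 0\<close> by simp
      qed
      define w where "w = Complex (of_int \<lfloor>Re z / h\<rfloor>) (of_int \<lfloor>Im z / h\<rfloor>)"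
      have "w \<in> S" unfolding S_def w_def
        using rnd [OF R(1)] rnd [OF R(2)] by (intro image_eqI [of _ _ "(_, _)"]) auto
      have "dist (h *\<^sub>R w) z \<le> \<bar>h * of_int \<lfloor>Re z / h\<rfloor> - Re z\<bar> + \<bar>h * of_int \<lfloor>Im z / h\<rfloor> - Im z\<bar>"
        using cmod_le [of "h *\<^sub>R w - z"] by (simp add: dist_norm w_def)
      also have "\<dots> \<le> h + h" by (intro add_mono err)
      also have "\<dots> = \<delta> / 2" by (simp add: h_def)
      finally have "z \<in> cball (h *\<^sub>R w) (\<delta> / 2)" by simp
      with \<open>w \<in> S\<close> show "z \<in> (\<Union>c\<in>(\<lambda>z. h *\<^sub>R z) ` S. cball c (\<delta> / 2))" by blast
    qed
  qed (use S in simp)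
qed

section \<open>Dimensions of stretched lattices\<close>

text \<open>The stretch fixes 0 even for a negative exponent, so for p > 0 the only accumulation
  point of the set belongs to it.\<close>

definition stretched_lattice :: "real \<Rightarrow> complex set" where
  "stretched_lattice p = stretch (- p) ` gaussian_ints"

lemma countable_stretched_lattice: "countable (stretched_lattice p)"
  by (simp add: stretched_lattice_def)

lemma zero_in_stretched_lattice: "0 \<in> stretched_lattice p"
proof -
  have "0 = (\<lambda>(i, j). Complex (of_int i) (of_int j)) (0, 0)" by (simp add: complex_eq_iff)
  then have "0 \<in> gaussian_ints" unfolding gaussian_ints_def by blast
  then show ?thesis unfolding stretched_lattice_def by (rule image_eqI [rotated]) simp
qed

lemma stretch_image_stretched_lattice:
  "stretch a ` stretched_lattice p = stretched_lattice (a * p)"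
  by (simp add: stretched_lattice_def image_image stretch_stretch)

text \<open>A member of the open cover containing c already contains all but finitely many points of
  A.\<close>

lemma compact_if_finite_outside_balls:
  fixes A :: "'a::metric_space set"
  assumes "c \<in> A" and fin: "\<And>e. 0 < e \<Longrightarrow> finite {x \<in> A. e \<le> dist c x}"
  shows "compact A"
proof (rule compactI)
  fix \<C> assume op: "\<forall>B\<in>\<C>. open B" and cov: "A \<subseteq> \<Union>\<C>"
  obtain B where B: "B \<in> \<C>" "c \<in> B" using cov \<open>c \<in> A\<close> by blast
  then obtain e where e: "0 < e" "ball c e \<subseteq> B" using op openE by blast
  define F where "F = {x \<in> A. e \<le> dist c x}"
  have "finite F" using fin e by (simp add: F_def)
  have "\<forall>x\<in>F. \<exists>B\<in>\<C>. x \<in> B" using cov by (auto simp: F_def)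
  then obtain U where U: "\<And>x. x \<in> F \<Longrightarrow> U x \<in> \<C> \<and> x \<in> U x" by metis
  have "A \<subseteq> \<Union> (insert B (U ` F))"
  proof
    fix x assume "x \<in> A"
    then show "x \<in> \<Union> (insert B (U ` F))"
      using U e by (cases "x \<in> F") (auto simp: F_def subset_iff)
  qed
  moreover have "finite (insert B (U ` F))" "insert B (U ` F) \<subseteq> \<C>"
    using \<open>finite F\<close> U B by auto
  ultimately show "\<exists>\<C>'\<subseteq>\<C>. finite \<C>' \<and> A \<subseteq> \<Union>\<C>'" by blast
qed

lemma compact_stretched_lattice:
  assumes "0 < p"
  shows "compact (stretched_lattice p)"
proof (rule compact_if_finite_outside_balls [OF zero_in_stretched_lattice])
  fix e :: real assume "0 < e"
  have "{x \<in> stretched_lattice p. e \<le> dist 0 x} \<subseteq>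
      stretch (- p) ` {z \<in> gaussian_ints. norm z \<le> e powr (- (1 / p))}"
  proof clarify
    fix x assume "x \<in> stretched_lattice p" "e \<le> dist 0 x"
    then obtain z where z: "z \<in> gaussian_ints" "x = stretch (- p) z" "e \<le> norm z powr (- p)"
      by (auto simp: stretched_lattice_def norm_stretch)
    have "(norm z powr (- p)) powr (- (1 / p)) \<le> e powr (- (1 / p))"
      using z \<open>0 < e\<close> assms by (intro powr_mono2') auto
    then have "norm z \<le> e powr (- (1 / p))" using assms by (simp add: powr_powr)
    with z show "x \<in> stretch (- p) ` {z \<in> gaussian_ints. norm z \<le> e powr (- (1 / p))}" by blast
  qed
  then show "finite {x \<in> stretched_lattice p. e \<le> dist 0 x}"
    by (rule finite_subset) (intro finite_imageI gaussian_ints_norm_le(1), simp)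
qed

text \<open>Singletons have diameter 0, so covering by them makes every sum vanish.\<close>

lemma hausdorff_dim_countable:
  fixes A :: "'a::euclidean_space set"
  assumes "countable A"
  shows "hausdorff_dim A = 0"
proof -
  have "hausdorff_measure s A = 0" if "0 < s" for s
  proof -
    have "hausdorff_premeasure \<delta> s A = 0" if "0 < \<delta>" for \<delta>
    proof -
      have "cover_sum s ((\<lambda>x. {x}) ` A) = 0"
        unfolding cover_sum_def using \<open>0 < s\<close> by (intro infsum_0) auto
      then have "hausdorff_premeasure \<delta> s A \<le> 0"
        unfolding hausdorff_premeasure_def using assms \<open>0 < \<delta>\<close>
        by (intro Inf_lower CollectI exI [of _ "(\<lambda>x. {x}) ` A"]) auto
      then show ?thesis by simp
    qed
    then show ?thesis unfolding hausdorff_measure_def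
      by (intro antisym SUP_least) auto
  qed
  then have "{s. 0 < s \<and> hausdorff_measure s A = 0} = {0<..}" by auto
  then show ?thesis by (simp add: hausdorff_dim_def)
qed

section \<open>Coverings at the two extreme scales\<close>

text \<open>Transfers a lower bound found on a finite subfamily to an arbitrary covering.\<close>

lemma sum_le_cover_sum:
  assumes "finite F" "F \<subseteq> \<C>"
  shows "ennreal (\<Sum>U\<in>F. diameter U powr s) \<le> cover_sum s \<C>"
proof -
  have "ennreal (\<Sum>U\<in>F. diameter U powr s) = (\<Sum>\<^sub>\<infinity>U\<in>F. ennreal (diameter U powr s))"
    using assms by simp
  also have "\<dots> \<le> cover_sum s \<C>"
    unfolding cover_sum_def using assms
    by (intro infsum_mono_neutral nonneg_summable_on_complete) auto
  finally show ?thesis .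
qed

text \<open>
  The scale \<open>N\<close> balances the two kinds of covering sets: lattice points of modulus at most \<open>N\<close>
  are covered one by one at scale \<open>\<delta> powr (1 / \<theta>)\<close>, the rest of the set lies in a disc of radius
  \<open>N powr - p\<close> and is covered at scale \<open>\<delta>\<close>.
\<close>

lemma critical_scale:
  fixes p \<theta> \<delta> :: real
  assumes "0 < p" "0 < \<theta>" "\<theta> \<le> 1" "0 < \<delta>" "\<delta> \<le> 1"
  defines "s \<equiv> 2 * \<theta> / (p + \<theta>)" and "N \<equiv> \<delta> powr (- 1 / (p + \<theta>))"
  shows "1 \<le> N" "0 < s" "s \<le> 2"
    and "N\<^sup>2 = (\<delta> powr (1 / \<theta>)) powr (- s)"
    and "N powr (- p) = \<delta> powr (p / (p + \<theta>))"
    and "(N powr (- p) / \<delta>)\<^sup>2 = \<delta> powr (- s)"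
    and "\<delta> \<le> N powr (- p)"
    and "N powr (2 * p) = \<delta> powr (s - 2)"
proof -
  note pos = assms(1-5)
  have "\<delta> powr 0 \<le> N" unfolding N_def using pos by (intro powr_mono') (auto simp: field_simps)
  then show "1 \<le> N" using pos by simp
  show "0 < s" "s \<le> 2" using pos by (auto simp: s_def field_simps)
  have s2: "s - 2 = - (2 * p / (p + \<theta>))" using pos by (simp add: s_def field_simps)
  have N2: "N\<^sup>2 = \<delta> powr (- 2 / (p + \<theta>))"
    unfolding N_def using pos by (simp add: powr_power)
  have "(1 / \<theta>) * (- s) = - 2 / (p + \<theta>)" using pos by (simp add: s_def)
  then show "N\<^sup>2 = (\<delta> powr (1 / \<theta>)) powr (- s)" unfolding N2 powr_powr by simp
  show Np: "N powr (- p) = \<delta> powr (p / (p + \<theta>))"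
    unfolding N_def powr_powr by simp
  have "(N powr (- p) / \<delta>) = \<delta> powr (p / (p + \<theta>) - 1)"
    unfolding Np using pos by (simp add: powr_diff)
  then have "(N powr (- p) / \<delta>)\<^sup>2 = \<delta> powr (2 * (p / (p + \<theta>) - 1))"
    using pos by (simp add: powr_power)
  also have "2 * (p / (p + \<theta>) - 1) = - s" using pos by (simp add: s_def field_simps)
  finally show "(N powr (- p) / \<delta>)\<^sup>2 = \<delta> powr (- s)" .
  have "\<delta> powr 1 \<le> \<delta> powr (p / (p + \<theta>))"
    using pos by (intro powr_mono') (auto simp: field_simps)
  then show "\<delta> \<le> N powr (- p)" unfolding Np using pos by simp
  show "N powr (2 * p) = \<delta> powr (s - 2)"
    unfolding N_def powr_powr s2 by simp
qed

text \<open>At exponent \<open>s\<close> the two families contribute at most 121 and 9, whatever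
  \<delta> is; this balance is what the choice of \<open>N\<close> achieves. The diameters are
  prescribed exactly, so that for \<theta> = 1 all sets have the same diameter, as the covering
  number demands.\<close>

lemma stretched_lattice_cover:
  fixes p \<theta> \<delta> :: real
  assumes "0 < p" "0 < \<theta>" "\<theta> \<le> 1" "0 < \<delta>" "\<delta> \<le> 1"
  defines "s \<equiv> 2 * \<theta> / (p + \<theta>)"
  obtains \<A> \<B> :: "complex set set" where
    "finite \<A>" "finite \<B>" "stretched_lattice p \<subseteq> \<Union> (\<A> \<union> \<B>)"
    "\<And>U. U \<in> \<A> \<Longrightarrow> bounded U \<and> diameter U = \<delta>"
    "\<And>U. U \<in> \<B> \<Longrightarrow> bounded U \<and> diameter U = \<delta> powr (1 / \<theta>)"
    "real (card \<A>) \<le> 121 * \<delta> powr (- s)"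
    "real (card \<B>) \<le> 9 * (\<delta> powr (1 / \<theta>)) powr (- s)"
proof -
  define N where "N = \<delta> powr (- 1 / (p + \<theta>))"
  note N = critical_scale [OF assms(1-5), folded s_def N_def]
  obtain P :: "complex set" where P: "finite P" "real (card P) \<le> (8 * N powr (- p) / \<delta> + 3)\<^sup>2"
    "cball 0 (N powr (- p)) \<subseteq> (\<Union>c\<in>P. cball c (\<delta> / 2))"
    using card_cover_ball [of \<delta> "N powr (- p)"] assms by auto
  define G where "G = {z \<in> gaussian_ints. norm z \<le> N}"
  have G: "finite G" "real (card G) \<le> (2 * N + 1)\<^sup>2"
    using gaussian_ints_norm_le [of N] N by (auto simp: G_def)
  show thesis
  proof (rule that [of "(\<lambda>c. cball c (\<delta> / 2)) ` P"
        "(\<lambda>z. cball (stretch (- p) z) (\<delta> powr (1 / \<theta>) / 2)) ` G"])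
    show "stretched_lattice p \<subseteq> \<Union> ((\<lambda>c. cball c (\<delta> / 2)) ` P \<union>
        (\<lambda>z. cball (stretch (- p) z) (\<delta> powr (1 / \<theta>) / 2)) ` G)"
    proof
      fix x assume "x \<in> stretched_lattice p"
      then obtain z where z: "z \<in> gaussian_ints" "x = stretch (- p) z"
        by (auto simp: stretched_lattice_def)
      show "x \<in> \<Union> ((\<lambda>c. cball c (\<delta> / 2)) ` P \<union>
          (\<lambda>z. cball (stretch (- p) z) (\<delta> powr (1 / \<theta>) / 2)) ` G)"
      proof (cases "norm z \<le> N")
        case True
        then have "z \<in> G" "x \<in> cball (stretch (- p) z) (\<delta> powr (1 / \<theta>) / 2)"
          using z by (auto simp: G_def)
        then show ?thesis by blast
      next
        case False
        have "norm x \<le> N powr (- p)"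
          unfolding z norm_stretch using False N(1) assms by (intro powr_mono2') auto
        then have "x \<in> cball 0 (N powr (- p))" by simp
        then show ?thesis using P(3) by blast
      qed
    qed
    have "real (card ((\<lambda>c. cball c (\<delta> / 2)) ` P)) \<le> (8 * N powr (- p) / \<delta> + 3)\<^sup>2"
      using card_image_le [OF P(1), of "\<lambda>c. cball c (\<delta> / 2)"] P(2) by linarith
    \<comment> \<open>The quotient is at least 1, which absorbs the summand 3 and gives 121 = 11^2.
      Likewise \<open>2 * N + 1\<close> is at most \<open>3 * N\<close> below, whence the 9.\<close>
    also have "\<dots> \<le> (11 * (N powr (- p) / \<delta>))\<^sup>2"
      using N(7) assms by (intro power_mono) (auto simp: field_simps)
    also have "\<dots> = 121 * \<delta> powr (- s)" unfolding power_mult_distrib N(6) by simp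
    finally show "real (card ((\<lambda>c. cball c (\<delta> / 2)) ` P)) \<le> 121 * \<delta> powr (- s)" .
    have "real (card ((\<lambda>z. cball (stretch (- p) z) (\<delta> powr (1 / \<theta>) / 2)) ` G)) \<le> (2 * N + 1)\<^sup>2"
      using card_image_le [OF G(1), of "\<lambda>z. cball (stretch (- p) z) (\<delta> powr (1 / \<theta>) / 2)"] G(2)
      by linarith
    also have "\<dots> \<le> (3 * N)\<^sup>2" using N(1) by (intro power_mono) auto
    also have "\<dots> = 9 * (\<delta> powr (1 / \<theta>)) powr (- s)" unfolding power_mult_distrib N(4) by simp
    finally show "real (card ((\<lambda>z. cball (stretch (- p) z) (\<delta> powr (1 / \<theta>) / 2)) ` G)) \<le>
        9 * (\<delta> powr (1 / \<theta>)) powr (- s)" .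
  qed (use P G assms in auto)
qed

section \<open>Lower bound for covering sums\<close>

text \<open>With \<sigma> of order N^(-p-1), the left side is of order d^2 N^(2p+2) + 1, and each
  summand is compared with N^2 d^s. For the one with d^2 the worst case is the largest diameter d =
  \<delta>, because s is at most 2; for the 1 it is the smallest, d =
  \<open>\<delta> powr (1 / \<theta>)\<close>. In both cases the powers of \<delta> cancel
  exactly.\<close>

lemma critical_scale_count:
  fixes p \<theta> \<delta> m d :: real
  assumes pos: "0 < p" "0 < \<theta>" "\<theta> \<le> 1" "0 < \<delta>" "\<delta> \<le> 1"
    and m: "0 < m" and d: "\<delta> powr (1 / \<theta>) \<le> d" "d \<le> \<delta>"
  defines "s \<equiv> 2 * \<theta> / (p + \<theta>)" and "N \<equiv> \<delta> powr (- 1 / (p + \<theta>))"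
  shows "(4 * d / (m * (2 * N) powr (- p - 1)) + 2)\<^sup>2 \<le>
    8 * (1 + 4 * 2 powr (2 * p + 2) / m\<^sup>2) * N\<^sup>2 * d powr s"
proof -
  note N = critical_scale [OF pos, folded s_def N_def]
  define \<sigma> where "\<sigma> = m * (2 * N) powr (- p - 1)"
  define C where "C = 4 * 2 powr (2 * p + 2) / m\<^sup>2"
  have "0 < \<delta> powr (1 / \<theta>)" using pos by simp
  then have "0 < d" using d by linarith
  have C: "4 * (1 / \<sigma>)\<^sup>2 = C * (N\<^sup>2 * N powr (2 * p))"
  proof -
    have "(2 * N) powr (- p - 1) = inverse ((2 * N) powr (p + 1))"
      using powr_minus [of "2 * N" "p + 1"] by simp
    then have "1 / \<sigma> = (2 * N) powr (p + 1) / m"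
      by (simp add: \<sigma>_def divide_inverse mult.commute)
    then have "(1 / \<sigma>)\<^sup>2 = ((2 * N) powr (p + 1))\<^sup>2 / m\<^sup>2" by (simp only: power_divide)
    also have "((2 * N) powr (p + 1))\<^sup>2 = (2 * N) powr (2 * p + 2)"
      using N(1) by (simp add: powr_power algebra_simps)
    also have "\<dots> = 2 powr (2 * p + 2) * (N powr (2 * p) * N powr 2)"
      using N(1) by (simp add: powr_mult powr_add mult_ac)
    also have "N powr 2 = N\<^sup>2" using N(1) by (simp add: powr_numeral)
    finally show ?thesis by (simp add: C_def mult_ac)
  qed
  \<comment> \<open>An instance of (x + y)^2 <= 2 (x^2 + y^2).\<close>
  have sq: "(4 * e + 2)\<^sup>2 \<le> 8 * (4 * e\<^sup>2 + 1)" for e :: real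
    using zero_le_power2 [of "4 * e - 2"] by (simp add: power2_eq_square algebra_simps)
  have "(4 * d / \<sigma> + 2)\<^sup>2 \<le> 8 * (4 * (d / \<sigma>)\<^sup>2 + 1)"
    using sq [of "d / \<sigma>"] by simp
  also have "4 * (d / \<sigma>)\<^sup>2 = d\<^sup>2 * (4 * (1 / \<sigma>)\<^sup>2)" by (simp add: power_divide)
  also have "\<dots> = C * (d\<^sup>2 * (N\<^sup>2 * N powr (2 * p)))" unfolding C by simp
  also have "8 * (C * (d\<^sup>2 * (N\<^sup>2 * N powr (2 * p))) + 1) \<le> 8 * (C * (N\<^sup>2 * d powr s) + N\<^sup>2 * d powr s)"
  proof -
    have "d powr (2 - s) \<le> \<delta> powr (2 - s)"
      using d N(3) \<open>0 < d\<close> by (intro powr_mono2) auto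
    then have "d powr (2 - s) * \<delta> powr (s - 2) \<le> \<delta> powr (2 - s) * \<delta> powr (s - 2)"
      by (intro mult_right_mono) auto
    also have "\<dots> = 1" using pos by (simp flip: powr_add)
    finally have 1: "d powr (2 - s) * N powr (2 * p) \<le> 1" unfolding N(8) .
    have "d powr s * d powr (2 - s) = d powr 2" unfolding powr_add [symmetric] by simp
    also have "\<dots> = d\<^sup>2" using \<open>0 < d\<close> by (simp add: powr_numeral)
    finally have "d\<^sup>2 = d powr s * d powr (2 - s)" ..
    then have "d\<^sup>2 * (N\<^sup>2 * N powr (2 * p)) = N\<^sup>2 * d powr s * (d powr (2 - s) * N powr (2 * p))"
      by (simp only: mult_ac)
    also have "\<dots> \<le> N\<^sup>2 * d powr s * 1" using 1 by (intro mult_left_mono) auto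
    finally have 2: "d\<^sup>2 * (N\<^sup>2 * N powr (2 * p)) \<le> N\<^sup>2 * d powr s" by simp
    have "(\<delta> powr (1 / \<theta>)) powr s \<le> d powr s"
      using d N(2) pos by (intro powr_mono2) auto
    then have "N\<^sup>2 * (\<delta> powr (1 / \<theta>)) powr s \<le> N\<^sup>2 * d powr s" by (intro mult_left_mono) auto
    moreover have "N\<^sup>2 * (\<delta> powr (1 / \<theta>)) powr s = 1"
      unfolding N(4) using pos by (simp flip: powr_add)
    ultimately have 3: "1 \<le> N\<^sup>2 * d powr s" by linarith
    have "0 \<le> C" by (simp add: C_def)
    then show ?thesis using 2 3 by (intro mult_left_mono add_mono) auto
  qed
  also have "\<dots> = 8 * (1 + C) * N\<^sup>2 * d powr s" by (simp add: algebra_simps)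
  finally show ?thesis unfolding \<sigma>_def C_def .
qed

text \<open>
  Mass distribution principle for the counting measure on the part of the lattice up to the
  critical scale.
\<close>

lemma stretched_lattice_cover_lower:
  fixes p \<theta> :: real
  assumes "0 < p" "0 < \<theta>" "\<theta> \<le> 1"
  defines "s \<equiv> 2 * \<theta> / (p + \<theta>)"
  obtains c where "0 < c"
    "\<And>\<delta> \<C>. 0 < \<delta> \<Longrightarrow> \<delta> \<le> 1 \<Longrightarrow> stretched_lattice p \<subseteq> \<Union>\<C> \<Longrightarrow>
      (\<And>U. U \<in> \<C> \<Longrightarrow> bounded U \<and> \<delta> powr (1 / \<theta>) \<le> diameter U \<and> diameter U \<le> \<delta>) \<Longrightarrow>
      \<exists>F\<subseteq>\<C>. finite F \<and> c \<le> (\<Sum>U\<in>F. diameter U powr s)"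
proof -
  define m where "m = min 1 p"
  have "m > 0" using assms by (simp add: m_def)
  define C where "C = 4 * 2 powr (2 * p + 2) / m\<^sup>2"
  have "C \<ge> 0" by (simp add: C_def)
  show thesis
  \<comment> \<open>The 32 is the 8 of the counting bound times the 4 lost when \<open>N\<close> is
    replaced by its integer part, which is at least \<open>N / 2\<close>.\<close>
  proof (rule that [of "1 / (32 * (1 + C))"])
    show "0 < 1 / (32 * (1 + C))" using \<open>C \<ge> 0\<close> by simp
    fix \<delta> :: real and \<C> :: "complex set set"
    assume \<delta>: "0 < \<delta>" "\<delta> \<le> 1" and cov: "stretched_lattice p \<subseteq> \<Union>\<C>"
      and diam: "\<And>U. U \<in> \<C> \<Longrightarrow> bounded U \<and> \<delta> powr (1 / \<theta>) \<le> diameter U \<and> diameter U \<le> \<delta>"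
    define N where "N = \<delta> powr (- 1 / (p + \<theta>))"
    note N = critical_scale [OF assms(1-3) \<delta>, folded s_def N_def]
    define n where "n = nat \<lfloor>N\<rfloor>"
    have n: "N / 2 \<le> real n" "real n \<le> N" 
  proof -
    have "1 \<le> \<lfloor>N\<rfloor>" using N(1) by simp
    moreover have "N < of_int \<lfloor>N\<rfloor> + 1" "of_int \<lfloor>N\<rfloor> \<le> N" by linarith+
    moreover have "real n = of_int \<lfloor>N\<rfloor>" using N(1) by (simp add: n_def)
    ultimately show "N / 2 \<le> real n" "real n \<le> N" by linarith+
  qed
    define \<sigma> where "\<sigma> = m * (2 * N) powr (- p - 1)"
    have "\<sigma> > 0" using \<open>m > 0\<close> N(1) by (simp add: \<sigma>_def)
    \<comment> \<open>A square block with positive coordinates has exactly n^2 points, misses the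
      origin and has moduli at most 2n; hence the \<open>2 * N\<close> in \<sigma>.\<close>
    define L where "L = (\<lambda>(i, j). Complex (of_nat i) (of_nat j)) ` ({1..n} \<times> {1..n})"
    have L: "finite L" "card L = n\<^sup>2"
      unfolding L_def
      by (auto simp: card_image inj_on_def card_cartesian_product power2_eq_square)
    have LG: "z \<in> gaussian_ints \<and> z \<noteq> 0 \<and> norm z \<le> 2 * N" if zL: "z \<in> L" for z
    proof -
      obtain i j where ij: "z = Complex (of_nat i) (of_nat j)" "i \<in> {1..n}" "j \<in> {1..n}"
        using zL by (auto simp: L_def)
      have "z = (\<lambda>(i, j). Complex (of_int i) (of_int j)) (int i, int j)" by (simp add: ij)
      then have "z \<in> gaussian_ints" unfolding gaussian_ints_def by blast
      moreover have "norm z \<le> real i + real j" using cmod_le [of z] by (simp add: ij)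
      then have "norm z \<le> 2 * N" using ij n by simp
      moreover have "z \<noteq> 0" using ij by (auto simp: complex_eq_iff)
      ultimately show ?thesis by blast
    qed
    have sep: "\<sigma> \<le> dist (stretch (- p) z) (stretch (- p) w)" if "z \<in> L" "w \<in> L" "z \<noteq> w" for z w
    proof -
      have "\<sigma> * 1 \<le> \<sigma> * dist z w"
        using that LG gaussian_ints_dist_ge \<open>\<sigma> > 0\<close> by (intro mult_left_mono) auto
      also have "\<dots> \<le> dist (stretch (- p) z) (stretch (- p) w)"
        unfolding \<sigma>_def m_def using that LG assms by (intro stretch_expansion) auto
      finally show ?thesis by simp
    qed
    define P where "P = stretch (- p) ` L"
    have "inj_on (stretch (- p)) L"
    proof (rule inj_onI, rule ccontr)
      fix z w assume "z \<in> L" "w \<in> L" "stretch (- p) z = stretch (- p) w" "z \<noteq> w"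
      with sep [of z w] \<open>\<sigma> > 0\<close> show False by simp
    qed
    then have cardP: "card P = n\<^sup>2" using L by (simp add: P_def card_image)
    have "finite P" using L by (simp add: P_def)
    have "P \<subseteq> stretched_lattice p"
      unfolding P_def stretched_lattice_def by (intro image_mono subsetI) (use LG in blast)
    then have "P \<subseteq> \<Union>\<C>" using cov by (rule order_trans)
    then have "\<And>x. x \<in> P \<Longrightarrow> \<exists>U. U \<in> \<C> \<and> x \<in> U" by (meson UnionE subsetD)
    then obtain U where U: "\<And>x. x \<in> P \<Longrightarrow> U x \<in> \<C> \<and> x \<in> U x" by metis
    \<comment> \<open>One covering member per point of \<open>P\<close> suffices to cover
      \<open>P\<close>, so the argument stays finite for an arbitrary covering.\<close>
    define F where "F = U ` P"
    have F: "finite F" "F \<subseteq> \<C>" "P \<subseteq> (\<Union>V\<in>F. P \<inter> V)"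
      using \<open>finite P\<close> U by (auto simp: F_def)
    have card_le: "real (card (P \<inter> V)) \<le> 8 * (1 + C) * N\<^sup>2 * diameter V powr s" if "V \<in> F" for V
    proof -
      define d where "d = diameter V"
      have V: "bounded V" "\<delta> powr (1 / \<theta>) \<le> d" "d \<le> \<delta>"
        using diam that F by (auto simp: d_def)
      have "0 < \<delta> powr (1 / \<theta>)" using \<delta> by simp
      then have "0 < d" using V by linarith
      have "real (card (P \<inter> V)) \<le> (4 * d / \<sigma> + 2)\<^sup>2"
        using sep V(1) \<open>\<sigma> > 0\<close> \<open>0 < d\<close>
        by (intro card_separated_le) (auto simp: P_def d_def diameter_bounded_bound)
      also have "\<dots> \<le> 8 * (1 + C) * N\<^sup>2 * d powr s"
        using critical_scale_count [OF assms(1-3) \<delta> \<open>m > 0\<close> V(2,3)]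
        unfolding s_def N_def \<sigma>_def C_def .
      finally show ?thesis by (simp only: d_def)
    qed
    have "(N / 2)\<^sup>2 \<le> (real n)\<^sup>2" using n N(1) by (intro power_mono) auto
    also have "\<dots> = real (card P)" by (simp add: cardP)
    also have "\<dots> \<le> real (card (\<Union>V\<in>F. P \<inter> V))"
      using F \<open>finite P\<close> by (intro of_nat_mono card_mono) auto
    also have "\<dots> \<le> (\<Sum>V\<in>F. real (card (P \<inter> V)))"
      using card_UN_le [OF F(1), of "\<lambda>V. P \<inter> V"] by (simp flip: of_nat_sum)
    also have "\<dots> \<le> (\<Sum>V\<in>F. 8 * (1 + C) * N\<^sup>2 * diameter V powr s)"
      by (intro sum_mono card_le)
    also have "\<dots> = N\<^sup>2 * (8 * (1 + C) * (\<Sum>V\<in>F. diameter V powr s))"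
      by (simp only: sum_distrib_left mult_ac)
    finally have "N\<^sup>2 * (1 / 4) \<le> N\<^sup>2 * (8 * (1 + C) * (\<Sum>V\<in>F. diameter V powr s))"
      by (simp add: power_divide)
    then have "1 / 4 \<le> 8 * (1 + C) * (\<Sum>V\<in>F. diameter V powr s)"
      by (rule mult_left_le_imp_le) (use N(1) in simp)
    then have "1 / (32 * (1 + C)) \<le> (\<Sum>V\<in>F. diameter V powr s)"
      using \<open>C \<ge> 0\<close> by (simp add: divide_le_eq algebra_simps)
    with F show "\<exists>F\<subseteq>\<C>. finite F \<and> 1 / (32 * (1 + C)) \<le> (\<Sum>U\<in>F. diameter U powr s)" by blast
  qed
qed

section \<open>Intermediate dimensions for \<theta> < 1\<close>

lemma cover_sum_finite:
  assumes "finite \<C>"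
  shows "cover_sum s \<C> = ennreal (\<Sum>U\<in>\<C>. diameter U powr s)"
  using assms by (simp add: cover_sum_def)

text \<open>Leaves open whether the threshold belongs to the set; at the critical exponent the
  covering sums stay away from 0.\<close>

lemma Inf_eq_threshold:
  fixes s\<^sub>0 :: real
  assumes "\<And>s. s\<^sub>0 < s \<Longrightarrow> s \<in> S" and "\<And>s. s \<in> S \<Longrightarrow> s\<^sub>0 \<le> s"
  shows "Inf S = s\<^sub>0"
proof (rule cInf_eq_non_empty)
  show "S \<noteq> {}" using assms(1) [of "s\<^sub>0 + 1"] by auto
  fix y assume y: "\<And>x. x \<in> S \<Longrightarrow> y \<le> x"
  show "y \<le> s\<^sub>0" by (rule dense_ge) (use assms(1) y in blast)
qed (rule assms(2))

lemma intermediate_dim_stretched_lattice_less_1: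
  fixes p \<theta> :: real
  assumes pos: "0 < p" "0 < \<theta>" "\<theta> < 1"
  shows "upper_intermediate_dim \<theta> (stretched_lattice p) = 2 * \<theta> / (p + \<theta>)"
proof -
  define s\<^sub>0 where "s\<^sub>0 = 2 * \<theta> / (p + \<theta>)"
  have "s\<^sub>0 > 0" using pos by (simp add: s\<^sub>0_def)
  define good where "good s \<delta> \<epsilon> \<longleftrightarrow>
    (\<exists>\<C>. countable \<C> \<and> stretched_lattice p \<subseteq> \<Union>\<C> \<and>
      (\<forall>U\<in>\<C>. bounded U \<and> \<delta> powr (1 / \<theta>) \<le> diameter U \<and> diameter U \<le> \<delta>) \<and>
      cover_sum s \<C> < ennreal \<epsilon>)" for s \<delta> \<epsilon> :: real
  have upper: "good s \<delta> \<epsilon>"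
    if "0 < \<delta>" "\<delta> \<le> 1"
      "121 * \<delta> powr (s - s\<^sub>0) + 9 * (\<delta> powr (1 / \<theta>)) powr (s - s\<^sub>0) < \<epsilon>" for s \<delta> \<epsilon>
  proof -
    obtain \<A> \<B> :: "complex set set" where AB:
      "finite \<A>" "finite \<B>" "stretched_lattice p \<subseteq> \<Union> (\<A> \<union> \<B>)"
      "\<And>U. U \<in> \<A> \<Longrightarrow> bounded U \<and> diameter U = \<delta>"
      "\<And>U. U \<in> \<B> \<Longrightarrow> bounded U \<and> diameter U = \<delta> powr (1 / \<theta>)"
      "real (card \<A>) \<le> 121 * \<delta> powr (- s\<^sub>0)"
      "real (card \<B>) \<le> 9 * (\<delta> powr (1 / \<theta>)) powr (- s\<^sub>0)"
      using stretched_lattice_cover [of p \<theta> \<delta>] pos \<open>0 < \<delta>\<close> \<open>\<delta> \<le> 1\<close> unfolding s\<^sub>0_def by auto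
    have "\<delta> powr (1 / \<theta>) \<le> \<delta> powr 1"
      using pos \<open>0 < \<delta>\<close> \<open>\<delta> \<le> 1\<close> by (intro powr_mono') auto
    then have \<delta>: "\<delta> powr (1 / \<theta>) \<le> \<delta>" using \<open>0 < \<delta>\<close> by simp
    have "(\<Sum>U\<in>\<A> \<union> \<B>. diameter U powr s) \<le> (\<Sum>U\<in>\<A>. diameter U powr s) + (\<Sum>U\<in>\<B>. diameter U powr s)"
      using AB(1,2) by (simp add: sum_Un sum_nonneg)
    also have "\<dots> = real (card \<A>) * \<delta> powr s + real (card \<B>) * (\<delta> powr (1 / \<theta>)) powr s"
      using AB(4,5) by simp
    also have "\<dots> \<le> 121 * \<delta> powr (- s\<^sub>0) * \<delta> powr s +
        9 * (\<delta> powr (1 / \<theta>)) powr (- s\<^sub>0) * (\<delta> powr (1 / \<theta>)) powr s"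
      using AB(6,7) by (intro add_mono mult_right_mono) auto
    also have "\<dots> = 121 * \<delta> powr (s - s\<^sub>0) + 9 * (\<delta> powr (1 / \<theta>)) powr (s - s\<^sub>0)"
      by (simp only: mult.assoc powr_add [symmetric]) simp
    finally have "cover_sum s (\<A> \<union> \<B>) < ennreal \<epsilon>"
      using AB(1,2) that(3) by (simp add: cover_sum_finite ennreal_less_iff sum_nonneg)
    moreover have "\<forall>U\<in>\<A> \<union> \<B>. bounded U \<and> \<delta> powr (1 / \<theta>) \<le> diameter U \<and> diameter U \<le> \<delta>"
      using AB(4,5) \<delta> by auto
    moreover have "countable (\<A> \<union> \<B>)" using AB(1,2) by (intro countable_finite) auto
    ultimately show ?thesis using AB(3) unfolding good_def by blast
  qed
  \<comment> \<open>For \<open>s > s\<^sub>0\<close> both terms of the upper estimate carry a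
    positive power of \<delta>, so they tend to 0.\<close>
  have above: "\<exists>\<delta>\<^sub>0>0. \<forall>\<delta>. 0 < \<delta> \<and> \<delta> \<le> \<delta>\<^sub>0 \<longrightarrow> good s \<delta> \<epsilon>" if "s\<^sub>0 < s" "0 < \<epsilon>" for s \<epsilon>
  proof -
    have "((\<lambda>\<delta>. 121 * \<delta> powr (s - s\<^sub>0) + 9 * (\<delta> powr (1 / \<theta>)) powr (s - s\<^sub>0)) \<longlongrightarrow>
        121 * 0 powr (s - s\<^sub>0) + 9 * (0 powr (1 / \<theta>)) powr (s - s\<^sub>0)) (at_right 0)"
      using that pos
      by (intro tendsto_intros tendsto_powr') (auto intro: eventually_mono [OF eventually_at_right_less])
    then have "\<forall>\<^sub>F \<delta> in at_right 0.
        121 * \<delta> powr (s - s\<^sub>0) + 9 * (\<delta> powr (1 / \<theta>)) powr (s - s\<^sub>0) < \<epsilon>"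
      using that by (intro order_tendstoD(2)) auto
    then obtain b where b: "b > 0"
      "\<And>\<delta>. 0 < \<delta> \<Longrightarrow> \<delta> < b \<Longrightarrow> 121 * \<delta> powr (s - s\<^sub>0) + 9 * (\<delta> powr (1 / \<theta>)) powr (s - s\<^sub>0) < \<epsilon>"
      by (auto simp: eventually_at_right_field)
    show ?thesis
      \<comment> \<open>Halving \<open>b\<close> turns the non-strict bound on \<delta> into the
        strict one; the cap 1 meets the hypothesis of \<open>upper\<close>.\<close>
      by (rule exI [of _ "min 1 (b / 2)"]) (use b upper in auto)
  qed
  have below: "s\<^sub>0 \<le> s"
    if s: "0 < s" "\<And>\<epsilon>. 0 < \<epsilon> \<Longrightarrow> \<exists>\<delta>\<^sub>0>0. \<forall>\<delta>. 0 < \<delta> \<and> \<delta> \<le> \<delta>\<^sub>0 \<longrightarrow> good s \<delta> \<epsilon>" for s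
  proof (rule ccontr)
    assume "\<not> s\<^sub>0 \<le> s"
    obtain c where "0 < c" and c:
      "\<And>\<delta> \<C>. 0 < \<delta> \<Longrightarrow> \<delta> \<le> 1 \<Longrightarrow> stretched_lattice p \<subseteq> \<Union>\<C> \<Longrightarrow>
        (\<And>U. U \<in> \<C> \<Longrightarrow> bounded U \<and> \<delta> powr (1 / \<theta>) \<le> diameter U \<and> diameter U \<le> \<delta>) \<Longrightarrow>
        \<exists>F\<subseteq>\<C>. finite F \<and> c \<le> (\<Sum>U\<in>F. diameter U powr s\<^sub>0)"
      using stretched_lattice_cover_lower [of p \<theta>] pos unfolding s\<^sub>0_def by auto
    obtain \<delta>\<^sub>0 where \<delta>\<^sub>0: "\<delta>\<^sub>0 > 0" "\<And>\<delta>. 0 < \<delta> \<Longrightarrow> \<delta> \<le> \<delta>\<^sub>0 \<Longrightarrow> good s \<delta> c"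
      using s(2) [OF \<open>0 < c\<close>] by blast
    \<comment> \<open>With \<delta> at most 1 all diameters are at most 1, so lowering the exponent
      from \<open>s\<^sub>0\<close> to \<open>s\<close> can only increase the sum. The bound
      \<open>c\<close> then contradicts the smallness granted for the tolerance
      \<open>c\<close>.\<close>
    define \<delta> where "\<delta> = min 1 \<delta>\<^sub>0"
    have \<delta>: "0 < \<delta>" "\<delta> \<le> 1" "\<delta> \<le> \<delta>\<^sub>0" using \<delta>\<^sub>0 by (auto simp: \<delta>_def)
    have "good s \<delta> c" using \<delta>\<^sub>0 \<delta> by blast
    then obtain \<C> where \<C>: "stretched_lattice p \<subseteq> \<Union>\<C>"
      "\<And>U. U \<in> \<C> \<Longrightarrow> bounded U \<and> \<delta> powr (1 / \<theta>) \<le> diameter U \<and> diameter U \<le> \<delta>"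
      "cover_sum s \<C> < ennreal c" unfolding good_def by blast
    obtain F where F: "F \<subseteq> \<C>" "finite F" "c \<le> (\<Sum>U\<in>F. diameter U powr s\<^sub>0)"
      using c [OF \<delta>(1,2) \<C>(1,2)] by blast
    have "diameter U powr s\<^sub>0 \<le> diameter U powr s" if "U \<in> F" for U
      using \<C>(2) [of U] F(1) that \<delta> \<open>\<not> s\<^sub>0 \<le> s\<close> diameter_ge_0 [of U] by (intro powr_mono') auto
    then have "c \<le> (\<Sum>U\<in>F. diameter U powr s)" using F(3) sum_mono order_trans by (metis (mono_tags, lifting))
    then have "ennreal c \<le> cover_sum s \<C>"
      using sum_le_cover_sum [OF F(2,1)] ennreal_leI order_trans by blast
    with \<C>(3) show False by simp
  qed
  have "Inf {s. 0 < s \<and> (\<forall>\<epsilon>>0. \<exists>\<delta>\<^sub>0>0. \<forall>\<delta>. 0 < \<delta> \<and> \<delta> \<le> \<delta>\<^sub>0 \<longrightarrow> good s \<delta> \<epsilon>)} = s\<^sub>0"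
    using above below \<open>s\<^sub>0 > 0\<close> by (intro Inf_eq_threshold) auto
  then show ?thesis
    using pos unfolding upper_intermediate_dim_def good_def s\<^sub>0_def by simp
qed

section \<open>Upper box dimension, the case \<theta> = 1\<close>

text \<open>For \<theta> = 1 the two scales coincide, and the covering sum is the number of sets
  times \<open>r powr s\<close>; the sum estimates become bounds on cardinalities. The constant 130
  is 121 + 9. The explicit covering also guarantees that the minimum in the covering number is
  attained.\<close>

lemma covering_number_stretched_lattice:
  fixes p :: real
  assumes "0 < p"
  obtains c where "0 < c"
    "\<And>r. 0 < r \<Longrightarrow> r \<le> 1 \<Longrightarrow> c * r powr (- (2 / (p + 1))) \<le> covering_number (stretched_lattice p) r"
    "\<And>r. 0 < r \<Longrightarrow> r \<le> 1 \<Longrightarrow> covering_number (stretched_lattice p) r \<le> 130 * r powr (- (2 / (p + 1)))"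
proof -
  define s where "s = 2 / (p + 1)"
  obtain c where "0 < c" and c:
    "\<And>\<delta> \<C>. 0 < \<delta> \<Longrightarrow> \<delta> \<le> 1 \<Longrightarrow> stretched_lattice p \<subseteq> \<Union>\<C> \<Longrightarrow>
      (\<And>U. U \<in> \<C> \<Longrightarrow> bounded U \<and> \<delta> powr 1 \<le> diameter U \<and> diameter U \<le> \<delta>) \<Longrightarrow>
      \<exists>F\<subseteq>\<C>. finite F \<and> c \<le> (\<Sum>U\<in>F. diameter U powr s)"
    using stretched_lattice_cover_lower [of p 1] assms unfolding s_def by auto
  define covers where "covers r n \<longleftrightarrow>
    (\<exists>\<C>. finite \<C> \<and> card \<C> = n \<and> stretched_lattice p \<subseteq> \<Union>\<C> \<and> (\<forall>U\<in>\<C>. bounded U \<and> diameter U = r))"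
    for r n
  have cn: "covering_number (stretched_lattice p) r = (LEAST n. covers r n)" for r
    by (simp add: covering_number_def covers_def)
  have ex: "\<exists>n. covers r n \<and> real n \<le> 130 * r powr (- s)" if r: "0 < r" "r \<le> 1" for r
  proof -
    obtain \<A> \<B> :: "complex set set" where AB:
      "finite \<A>" "finite \<B>" "stretched_lattice p \<subseteq> \<Union> (\<A> \<union> \<B>)"
      "\<And>U. U \<in> \<A> \<Longrightarrow> bounded U \<and> diameter U = r"
      "\<And>U. U \<in> \<B> \<Longrightarrow> bounded U \<and> diameter U = r"
      "real (card \<A>) \<le> 121 * r powr (- s)" "real (card \<B>) \<le> 9 * r powr (- s)"
      using stretched_lattice_cover [of p 1 r] assms r unfolding s_def by auto
    have "covers r (card (\<A> \<union> \<B>))"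
      unfolding covers_def using AB(1-5) by (intro exI [of _ "\<A> \<union> \<B>"]) blast
    moreover have "real (card (\<A> \<union> \<B>)) \<le> 130 * r powr (- s)"
      using card_Un_le [of \<A> \<B>] AB(6,7) by linarith
    ultimately show ?thesis by blast
  qed
  show thesis
  proof (rule that [OF \<open>0 < c\<close>])
    fix r :: real assume r: "0 < r" "r \<le> 1"
    obtain n where n: "covers r n" "real n \<le> 130 * r powr (- s)" using ex [OF r] by blast
    have "covering_number (stretched_lattice p) r \<le> n" unfolding cn using n(1) by (rule Least_le)
    then show "covering_number (stretched_lattice p) r \<le> 130 * r powr (- (2 / (p + 1)))"
      using n(2) unfolding s_def by linarith
    have "covers r (covering_number (stretched_lattice p) r)" unfolding cn using n(1) by (rule LeastI)
    then obtain \<C> where \<C>: "finite \<C>" "card \<C> = covering_number (stretched_lattice p) r"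
      "stretched_lattice p \<subseteq> \<Union>\<C>" "\<And>U. U \<in> \<C> \<Longrightarrow> bounded U \<and> diameter U = r"
      unfolding covers_def by blast
    have "\<exists>F\<subseteq>\<C>. finite F \<and> c \<le> (\<Sum>U\<in>F. diameter U powr s)"
      using c [OF r \<C>(3)] \<C>(4) r by simp
    then obtain F where F: "F \<subseteq> \<C>" "c \<le> (\<Sum>U\<in>F. diameter U powr s)" by blast
    have "(\<Sum>U\<in>F. diameter U powr s) \<le> (\<Sum>U\<in>\<C>. diameter U powr s)"
      using F(1) \<C>(1) by (intro sum_mono2) auto
    also have "\<dots> = covering_number (stretched_lattice p) r * r powr s"
      using \<C> by simp
    finally have "c * r powr (- s) \<le> covering_number (stretched_lattice p) r * r powr s * r powr (- s)"
      using F(2) by (intro mult_right_mono) auto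
    also have "\<dots> = covering_number (stretched_lattice p) r"
      using r by (simp add: mult.assoc flip: powr_add)
    finally show "c * r powr (- (2 / (p + 1))) \<le> covering_number (stretched_lattice p) r"
      unfolding s_def .
  qed
qed

text \<open>Constant factors only add \<open>ln k / - ln r\<close>, which tends to 0, so both bounds
  have the same limit s and the upper limit is a limit.\<close>

lemma upper_box_dim_eqI:
  fixes A :: "'a::euclidean_space set"
  assumes "0 < c" "0 < C"
    and "\<And>r. 0 < r \<Longrightarrow> r \<le> 1 \<Longrightarrow> c * r powr (- s) \<le> covering_number A r"
    and "\<And>r. 0 < r \<Longrightarrow> r \<le> 1 \<Longrightarrow> covering_number A r \<le> C * r powr (- s)"
  shows "upper_box_dim A = s"
proof -
  define L where "L k r = s + ln k / - ln r" for k r :: real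
  have L: "(L k \<longlongrightarrow> s) (at_right 0)" for k
  proof -
    have "filterlim (\<lambda>r::real. - ln r) at_top (at_right 0)"
      by (simp add: filterlim_uminus_at_top ln_at_0)
    then have "((\<lambda>r. ln k / - ln r) \<longlongrightarrow> 0) (at_right 0)"
      by (intro real_tendsto_divide_at_top [OF tendsto_const])
    from tendsto_add [OF tendsto_const this, of s] show ?thesis by (simp add: L_def [abs_def])
  qed
  have small: "\<forall>\<^sub>F r::real in at_right 0. 0 < r \<and> r < 1"
    by (auto simp: eventually_at_right_field intro: exI [of _ 1])
  have ln: "ln (k * r powr (- s)) / - ln r = L k r" if "0 < k" "0 < r" "r < 1" for k r
    using that by (simp add: L_def ln_mult ln_powr field_simps)
  have "((\<lambda>r. ln (real (covering_number A r)) / - ln r) \<longlongrightarrow> s) (at_right 0)"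
  proof (rule tendsto_sandwich [OF _ _ L [of c] L [of C]])
    show "\<forall>\<^sub>F r in at_right 0. L c r \<le> ln (real (covering_number A r)) / - ln r"
      using small
    proof eventually_elim
      case (elim r)
      have "ln (c * r powr (- s)) \<le> ln (real (covering_number A r))"
        using assms elim by (intro ln_mono) auto
      then show ?case using elim assms by (subst ln [symmetric]) (auto intro!: divide_right_mono simp del: divide_minus_right)
    qed
    show "\<forall>\<^sub>F r in at_right 0. ln (real (covering_number A r)) / - ln r \<le> L C r"
      using small
    proof eventually_elim
      case (elim r)
      \<comment> \<open>The lower bound makes the covering number positive, as monotonicity of the
        logarithm requires.\<close>
      have "0 < c * r powr (- s)" using elim assms by simp
      also have "\<dots> \<le> covering_number A r" using elim assms by auto
      finally have "ln (real (covering_number A r)) \<le> ln (C * r powr (- s))"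
        using assms elim by (intro ln_mono) auto
      then show ?case using elim assms by (subst ln [symmetric]) (auto intro!: divide_right_mono simp del: divide_minus_right)
    qed
  qed
  then have "((\<lambda>r. ereal (ln (real (covering_number A r)) / - ln r)) \<longlongrightarrow> ereal s) (at_right 0)"
    by (rule tendsto_ereal)
  then have "Limsup (at_right 0) (\<lambda>r. ereal (ln (real (covering_number A r)) / - ln r)) = ereal s"
    by (intro lim_imp_Limsup) auto
  then show ?thesis by (simp add: upper_box_dim_def)
qed

lemma intermediate_dim_stretched_lattice:
  fixes p \<theta> :: real
  assumes "0 < p" "0 < \<theta>" "\<theta> \<le> 1"
  shows "upper_intermediate_dim \<theta> (stretched_lattice p) = 2 * \<theta> / (p + \<theta>)"
proof (cases "\<theta> = 1")
  case True
  obtain c where c: "0 < c"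
    "\<And>r. 0 < r \<Longrightarrow> r \<le> 1 \<Longrightarrow> c * r powr (- (2 / (p + 1))) \<le> covering_number (stretched_lattice p) r"
    "\<And>r. 0 < r \<Longrightarrow> r \<le> 1 \<Longrightarrow> covering_number (stretched_lattice p) r \<le> 130 * r powr (- (2 / (p + 1)))"
    using covering_number_stretched_lattice [OF \<open>0 < p\<close>] by blast
  then have "upper_box_dim (stretched_lattice p) = 2 / (p + 1)"
    by (intro upper_box_dim_eqI [of c 130]) auto
  with True show ?thesis by (simp add: upper_intermediate_dim_def)
qed (use assms intermediate_dim_stretched_lattice_less_1 in auto)

section \<open>Quasiconformality of radial stretches\<close>

text \<open>Translation invariance of Lebesgue measure makes the integral of every difference
  quotient vanish. Bounded support and the mean value inequality supply the majorant for the
  limit.\<close>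

lemma integral_directional_derivative_eq_0:
  fixes F :: "'a::euclidean_space \<Rightarrow> 'b::euclidean_space"
  assumes der: "\<And>x. (F has_derivative F' x) (at x)"
    and cont: "continuous_on UNIV (\<lambda>x. F' x e)"
    and supp: "\<And>x. R < norm x \<Longrightarrow> F x = 0"
  shows "(LINT x|lborel. F' x e) = 0"
proof -
  have contF: "continuous_on UNIV F"
    using der has_derivative_continuous continuous_at_imp_continuous_on by blast
  have [measurable]: "F \<in> borel_measurable borel" "(\<lambda>x. F' x e) \<in> borel_measurable borel"
    using contF cont by (auto intro: borel_measurable_continuous_onI)
  \<comment> \<open>Quotients with step at most 1 vanish beyond radius \<open>R + norm e\<close>,
    and the intermediate points of the mean value inequality lie at most \<open>norm e\<close>
    further out.\<close>
  have "compact ((\<lambda>x. F' x e) ` cball 0 (R + 2 * norm e))"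
    using cont by (intro compact_continuous_image continuous_on_subset [OF cont]) auto
  then have "bounded ((\<lambda>x. F' x e) ` cball 0 (R + 2 * norm e))"
    by (rule compact_imp_bounded)
  then obtain M where M: "\<And>x. norm x \<le> R + 2 * norm e \<Longrightarrow> norm (F' x e) \<le> M"
    by (force simp: bounded_iff)
  define h where "h n = 1 / real (Suc n)" for n
  have h: "0 < h n" "h n \<le> 1" for n by (auto simp: h_def)
  define q where "q n x = (1 / h n) *\<^sub>R (F (h n *\<^sub>R e + x) - F x)" for n x
  have line: "((\<lambda>t. F (t *\<^sub>R e + x)) has_derivative (\<lambda>u. u *\<^sub>R F' (t *\<^sub>R e + x) e)) (at t)" for t x
  proof -
    have "((\<lambda>t. F (t *\<^sub>R e + x)) has_derivative (\<lambda>u. F' (t *\<^sub>R e + x) (u *\<^sub>R e))) (at t)"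
      by (rule has_derivative_compose [OF _ der]) (auto intro!: derivative_eq_intros)
    then show ?thesis
      using linear_cmul [OF has_derivative_linear [OF der]] by simp
  qed
  have q_bound: "norm (q n x) \<le> M * indicator (cball 0 (R + norm e)) x" for n x
  proof (cases "norm x \<le> R + norm e")
    case True
    have "\<exists>t\<in>{0<..<h n}. norm (F (h n *\<^sub>R e + x) - F (0 *\<^sub>R e + x)) \<le>
        norm ((h n - 0) *\<^sub>R F' (t *\<^sub>R e + x) e)"
      using line by (intro mvt_general h has_derivative_continuous_on)
        (auto intro: has_derivative_at_withinI)
    then obtain t where t: "0 < t" "t < h n"
      "norm (F (h n *\<^sub>R e + x) - F x) \<le> h n * norm (F' (t *\<^sub>R e + x) e)"
      using h [of n] by auto
    have "norm (t *\<^sub>R e + x) \<le> t * norm e + norm x"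
      using norm_triangle_ineq [of "t *\<^sub>R e" x] t by simp
    also have "\<dots> \<le> 1 * norm e + (R + norm e)"
      using t h [of n] True by (intro add_mono mult_right_mono) auto
    finally have "norm (F' (t *\<^sub>R e + x) e) \<le> M" by (intro M) simp
    then have "h n * norm (F' (t *\<^sub>R e + x) e) \<le> h n * M" using h [of n] by (intro mult_left_mono) auto
    with t(3) have "norm (F (h n *\<^sub>R e + x) - F x) \<le> h n * M" by linarith
    then show ?thesis using h [of n] True by (simp add: q_def divide_le_eq mult.commute)
  next
    case False
    have "norm x \<le> norm (h n *\<^sub>R e + x) + norm (h n *\<^sub>R e)"
      using norm_triangle_ineq4 [of "h n *\<^sub>R e + x" "h n *\<^sub>R e"] by simp
    moreover have "norm (h n *\<^sub>R e) \<le> norm e"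
      using h [of n] by (simp add: mult_left_le_one_le)
    ultimately have "R < norm (h n *\<^sub>R e + x)" using False by linarith
    moreover have "R < norm x" using False norm_ge_zero [of e] by linarith
    ultimately show ?thesis using False by (simp add: q_def supp)
  qed
  have q_lim: "(\<lambda>n. q n x) \<longlonglongrightarrow> F' x e" for x
  proof -
    have "((\<lambda>t. norm (F (t *\<^sub>R e + x) - F x - t *\<^sub>R F' x e) / norm t) \<longlongrightarrow> 0) (at 0)"
      using line [of x 0] by (simp add: has_derivative_at)
    then have "((\<lambda>t. norm ((1 / t) *\<^sub>R (F (t *\<^sub>R e + x) - F x) - F' x e)) \<longlongrightarrow> 0) (at 0)"
    proof (rule Lim_transform_eventually)
      have "norm (F (t *\<^sub>R e + x) - F x - t *\<^sub>R F' x e) / norm t =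
          norm ((1 / t) *\<^sub>R (F (t *\<^sub>R e + x) - F x) - F' x e)" if "t \<noteq> 0" for t
      proof -
        have "(1 / t) *\<^sub>R (F (t *\<^sub>R e + x) - F x) - F' x e =
            (1 / t) *\<^sub>R (F (t *\<^sub>R e + x) - F x - t *\<^sub>R F' x e)"
          using that by (simp add: algebra_simps)
        then show ?thesis by simp
      qed
      then show "\<forall>\<^sub>F t in at 0. norm (F (t *\<^sub>R e + x) - F x - t *\<^sub>R F' x e) / norm t =
          norm ((1 / t) *\<^sub>R (F (t *\<^sub>R e + x) - F x) - F' x e)"
        by (rule eventually_mono [OF eventually_neq_at_within])
    qed
    then have "((\<lambda>t. (1 / t) *\<^sub>R (F (t *\<^sub>R e + x) - F x)) \<longlongrightarrow> F' x e) (at 0)"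
      by (rule LIM_zero_cancel [OF tendsto_norm_zero_cancel])
    moreover have "filterlim h (at 0) sequentially"
      unfolding filterlim_at
    proof
      show "h \<longlonglongrightarrow> 0" unfolding h_def by (rule LIMSEQ_Suc) (rule lim_1_over_n)
    qed (simp add: h_def)
    ultimately show ?thesis unfolding q_def by (rule filterlim_compose)
  qed
  have int: "integrable lborel F"
  proof -
    have "compact (F ` cball 0 R)"
      by (intro compact_continuous_image continuous_on_subset [OF contF]) auto
    then obtain B where "\<And>x. norm x \<le> R \<Longrightarrow> norm (F x) \<le> B"
      using compact_imp_bounded by (force simp: bounded_iff)
    then show ?thesis using supp
      by (intro integrableI_bounded_set [where A = "cball 0 R" and B = B])
        (auto simp: emeasure_lborel_cball_finite [unfolded infinity_ennreal_def])
  qed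
  have q_int: "(LINT x|lborel. q n x) = 0" for n
  proof -
    have "integrable (distr lborel borel ((+) (h n *\<^sub>R e))) F" "(LINT x|lborel. F x) = (LINT x|distr lborel borel ((+) (h n *\<^sub>R e)). F x)"
      using int by (simp_all add: lborel_distr_plus)
    then have "integrable lborel (\<lambda>x. F (h n *\<^sub>R e + x))" "(LINT x|lborel. F x) = (LINT x|lborel. F (h n *\<^sub>R e + x))"
      by (simp_all add: integrable_distr_eq integral_distr)
    then show ?thesis using int by (simp add: q_def)
  qed
  have "(\<lambda>n. LINT x|lborel. q n x) \<longlonglongrightarrow> (LINT x|lborel. F' x e)"
  proof (rule integral_dominated_convergence)
    show "integrable lborel (\<lambda>x. M * indicator (cball 0 (R + norm e)) x)"
      by (intro integrable_mult_right) (simp add: integrable_indicator_iff emeasure_lborel_cball_finite [unfolded infinity_ennreal_def])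
  qed (use q_bound q_lim in \<open>auto simp: q_def\<close>)
  then show ?thesis by (simp add: q_int LIMSEQ_const_iff)
qed

text \<open>On the shell between radii \<open>R / 2 ^ Suc k\<close> and \<open>R / 2 ^ k\<close> the
  power is at most its value at the inner radius. Multiplying this by the area of the whole outer
  disc gives a geometric series of ratio \<open>1 / 2 powr (b + 2)\<close>, convergent because b >
  -2. The origin contributes nothing, as \<open>0 powr b = 0\<close>.\<close>

lemma integrable_norm_powr_on_cball:
  fixes b R :: real
  assumes "- 2 < b" "b \<le> 0"
  shows "integrable lborel (\<lambda>z::complex. indicator (cball 0 R) z * norm z powr b)"
proof (cases "0 < R")
  case False
  have "indicator (cball 0 R) z * norm z powr b = 0" for z :: complex
  proof -
    have "z = 0 \<or> R < norm z" using False zero_less_norm_iff [of z] by linarith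
    then show ?thesis by auto
  qed
  then show ?thesis by (simp only: integrable_zero)
next
  case True
  define w where "w k z = ennreal ((R / 2 ^ Suc k) powr b) * indicator (cball 0 (R / 2 ^ k)) z" for k and z :: complex
  have le: "ennreal (indicator (cball 0 R) z * norm z powr b) \<le> (\<Sum>k. w k z)" for z
  proof (cases "z \<noteq> 0 \<and> norm z \<le> R")
    case z: True
    have "(\<lambda>k. R / 2 ^ Suc k) \<longlonglongrightarrow> 0"
      by (rule LIMSEQ_Suc) (rule LIMSEQ_divide_realpow_zero, simp)
    then have "\<forall>\<^sub>F k in sequentially. R / 2 ^ Suc k < norm z"
      using z by (intro order_tendstoD) auto
    then have "\<exists>k. R / 2 ^ Suc k < norm z" by (rule eventually_happens' [OF sequentially_bot])
    then have ex: "\<exists>k. R / 2 ^ Suc k \<le> norm z" using less_imp_le by blast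
    \<comment> \<open>Minimality makes \<open>k\<close> the index of the shell containing
      \<open>z\<close>: the preceding radius still exceeds the modulus.\<close>
    define k where "k = (LEAST k. R / 2 ^ Suc k \<le> norm z)"
    have k: "R / 2 ^ Suc k \<le> norm z" unfolding k_def using ex by (rule LeastI_ex)
    have k': "norm z \<le> R / 2 ^ k"
    proof (cases k)
      case 0
      then show ?thesis using z by simp
    next
      case (Suc j)
      then have "\<not> R / 2 ^ Suc j \<le> norm z" unfolding k_def by (metis lessI not_less_Least)
      then show ?thesis by (simp add: Suc)
    qed
    have "norm z powr b \<le> (R / 2 ^ Suc k) powr b"
      using k True assms by (intro powr_mono2') auto
    then have "ennreal (indicator (cball 0 R) z * norm z powr b) \<le> w k z"
      using z k' by (simp add: w_def ennreal_leI)
    also have "\<dots> \<le> (\<Sum>k. w k z)"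
      using sum_le_suminf [OF summableI, of "{k}" "\<lambda>k. w k z"] by simp
    finally show ?thesis .
  qed auto
  have meas: "w k \<in> borel_measurable lborel" for k
    unfolding w_def [abs_def]
    by (intro borel_measurable_times_ennreal borel_measurable_const borel_measurable_indicator) simp
  define C where "C = unit_ball_vol 2 * R powr (b + 2) * 2 powr (- b)"
  define q where "q = 1 / (2::real) powr (b + 2)"
  have "C \<ge> 0" by (simp add: C_def unit_ball_vol_nonneg)
  have nn: "(\<integral>\<^sup>+z. w k z \<partial>lborel) = ennreal (C * q ^ k)" for k
  proof -
    have "(\<integral>\<^sup>+z. w k z \<partial>lborel) = ennreal ((R / 2 ^ Suc k) powr b) * emeasure lborel (cball (0::complex) (R / 2 ^ k))"
      unfolding w_def by (subst nn_integral_cmult_indicator) auto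
    also have "\<dots> = ennreal ((R / 2 ^ Suc k) powr b * (unit_ball_vol 2 * (R / 2 ^ k)\<^sup>2))"
      using True by (subst emeasure_cball) (simp_all add: ennreal_mult)
    also have "(R / 2 ^ Suc k) powr b * (unit_ball_vol 2 * (R / 2 ^ k)\<^sup>2) = C * q ^ k"
    proof -
      define \<rho> where "\<rho> = R / 2 ^ k"
      have "\<rho> > 0" using True by (simp add: \<rho>_def)
      have "(2 ^ k) powr (b + 2) = (2 powr real k) powr (b + 2)" by (simp only: powr_realpow zero_less_numeral)
      also have "\<dots> = (2 powr (b + 2)) ^ k" by (simp only: powr_powr powr_power)
      finally have "\<rho> powr (b + 2) = R powr (b + 2) * q ^ k"
        using True by (simp add: \<rho>_def q_def powr_divide power_divide)
      moreover have "R / 2 ^ Suc k = \<rho> / 2" by (simp add: \<rho>_def)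
      moreover have "(\<rho> / 2) powr b * \<rho>\<^sup>2 = \<rho> powr (b + 2) * 2 powr (- b)"
      proof -
        have "(\<rho> / 2) powr b = \<rho> powr b * 2 powr (- b)"
          using \<open>\<rho> > 0\<close> by (simp add: powr_divide powr_minus_divide)
        moreover have "\<rho>\<^sup>2 = \<rho> powr 2" using \<open>\<rho> > 0\<close> by simp
        ultimately show ?thesis by (simp only: powr_add mult_ac)
      qed
      ultimately have "(R / 2 ^ Suc k) powr b * \<rho>\<^sup>2 = R powr (b + 2) * q ^ k * 2 powr (- b)"
        by (simp only:)
      then show ?thesis unfolding C_def \<rho>_def [symmetric] by (simp only: mult_ac)
    qed
    finally show ?thesis .
  qed
  have "(2::real) powr 0 < 2 powr (b + 2)"
    using assms by (intro powr_less_mono) auto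
  then have "q < 1" "0 \<le> q" by (simp_all add: q_def)
  then have sm: "summable (\<lambda>k. C * q ^ k)"
    using \<open>q < 1\<close> \<open>0 \<le> q\<close> by (intro summable_mult summable_geometric) simp
  have "(\<integral>\<^sup>+z. ennreal (indicator (cball 0 R) z * norm (z::complex) powr b) \<partial>lborel) \<le>
      (\<integral>\<^sup>+z. (\<Sum>k. w k z) \<partial>lborel)"
    by (intro nn_integral_mono le)
  also have "\<dots> = (\<Sum>k. ennreal (C * q ^ k))"
    by (subst nn_integral_suminf) (use meas in \<open>simp_all add: nn\<close>)
  also have "\<dots> < top"
  proof -
    have "0 \<le> C * q ^ k" for k using \<open>C \<ge> 0\<close> \<open>0 \<le> q\<close> by (intro mult_nonneg_nonneg) auto
    then have "(\<Sum>k. ennreal (C * q ^ k)) \<noteq> top" by (rule ennreal_suminf_neq_top [OF sm])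
    then show ?thesis by (simp add: less_top)
  qed
  finally have fin: "(\<integral>\<^sup>+z. ennreal (indicator (cball 0 R) z * norm (z::complex) powr b) \<partial>lborel) < \<infinity>"
    by simp
  have "(\<lambda>z::complex. indicator (cball 0 R) z * norm z powr b) \<in> borel_measurable lborel"
  proof -
    have "(\<lambda>z::complex. norm z powr b) \<in> borel_measurable lborel" by measurable
    then show ?thesis by (intro borel_measurable_times borel_measurable_indicator) simp_all
  qed
  moreover have "AE z::complex in lborel. 0 \<le> indicator (cball 0 R) z * norm z powr b"
    by (intro always_eventually allI mult_nonneg_nonneg) auto
  ultimately show ?thesis using fin by (rule integrableI_nonneg)
qed

text \<open>
  \<open>\<epsilon> = 0\<close> gives \<^const>\<open>stretch\<close>; for \<open>\<epsilon> > 0\<close> the singularity at the origin is smoothed out.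
\<close>

definition smooth_stretch :: "real \<Rightarrow> real \<Rightarrow> complex \<Rightarrow> complex" where
  "smooth_stretch a \<epsilon> z = ((norm z)\<^sup>2 + \<epsilon>) powr ((a - 1) / 2) *\<^sub>R z"

text \<open>Also used with \<epsilon> = 0, as the candidate for the weak differential of the
  stretch; there its value at the origin is 0.\<close>

definition smooth_stretch_deriv :: "real \<Rightarrow> real \<Rightarrow> complex \<Rightarrow> complex \<Rightarrow> complex" where
  "smooth_stretch_deriv a \<epsilon> z h =
    ((norm z)\<^sup>2 + \<epsilon>) powr ((a - 1) / 2) *\<^sub>R (h + ((a - 1) * (z \<bullet> h) / ((norm z)\<^sup>2 + \<epsilon>)) *\<^sub>R z)"

section \<open>Smoothed stretches: derivative and bounds uniform in \<epsilon>\<close>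

lemma norm_sq_powr_half:
  fixes z :: "'a::real_normed_vector"
  shows "((norm z)\<^sup>2) powr (b / 2) = norm z powr b"
proof (cases "z = 0")
  case False
  then have "(norm z)\<^sup>2 = norm z powr 2" by simp
  then show ?thesis by (simp only: powr_powr) simp
qed simp

lemma smooth_stretch_0: "smooth_stretch a 0 = stretch a"
  by (simp add: fun_eq_iff smooth_stretch_def stretch_def norm_sq_powr_half)

lemma smooth_stretch_has_derivative:
  assumes "0 < \<epsilon>"
  shows "(smooth_stretch a \<epsilon> has_derivative smooth_stretch_deriv a \<epsilon> z) (at z)"
proof -
  have pos: "0 < z \<bullet> z + \<epsilon>" using assms by (intro add_nonneg_pos) auto
  have "((\<lambda>z. (z \<bullet> z + \<epsilon>) powr ((a - 1) / 2) *\<^sub>R z) has_derivative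
    (\<lambda>h. (z \<bullet> z + \<epsilon>) powr ((a - 1) / 2) *\<^sub>R h +
      ((z \<bullet> z + \<epsilon>) powr ((a - 1) / 2) *
        (0 * ln (z \<bullet> z + \<epsilon>) + (z \<bullet> h + h \<bullet> z + 0) * ((a - 1) / 2) / (z \<bullet> z + \<epsilon>))) *\<^sub>R z)) (at z)"
    by (intro has_derivative_scaleR has_derivative_powr has_derivative_add has_derivative_inner
        has_derivative_ident has_derivative_const pos UNIV_I)
  also have "(\<lambda>h. (z \<bullet> z + \<epsilon>) powr ((a - 1) / 2) *\<^sub>R h +
      ((z \<bullet> z + \<epsilon>) powr ((a - 1) / 2) *
        (0 * ln (z \<bullet> z + \<epsilon>) + (z \<bullet> h + h \<bullet> z + 0) * ((a - 1) / 2) / (z \<bullet> z + \<epsilon>))) *\<^sub>R z) =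
      smooth_stretch_deriv a \<epsilon> z"
    by (simp add: fun_eq_iff smooth_stretch_deriv_def power2_norm_eq_inner inner_commute
        scaleR_add_right mult_ac)
  finally show ?thesis unfolding smooth_stretch_def [abs_def] power2_norm_eq_inner .
qed

text \<open>Apart from the weight, the map is the identity on the orthogonal complement of z and
  multiplies the direction of z by a factor between a and 1, so it does not increase norms.\<close>

lemma norm_smooth_stretch_deriv_le:
  assumes "0 \<le> \<epsilon>" "0 < a" "a \<le> 1"
  shows "norm (smooth_stretch_deriv a \<epsilon> z h) \<le> ((norm z)\<^sup>2 + \<epsilon>) powr ((a - 1) / 2) * norm h"
proof -
  define c where "c = (a - 1) / ((norm z)\<^sup>2 + \<epsilon>)"
  define r where "r = (norm z)\<^sup>2 / ((norm z)\<^sup>2 + \<epsilon>)"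
  define u where "u = (1 - a) * r"
  have "c * (norm z)\<^sup>2 = - u"
    by (simp add: c_def r_def u_def diff_divide_distrib algebra_simps)
  moreover have "r \<le> 1"
    using assms by (auto simp: r_def divide_le_eq add_nonneg_pos less_le)
  then have "u \<le> (1 - a) * 1" unfolding u_def using assms by (intro mult_left_mono) auto
  then have "u \<le> 1" using assms by simp
  ultimately have "0 \<le> 2 + c * (norm z)\<^sup>2" by simp
  moreover have "c \<le> 0" using assms by (simp add: c_def divide_nonpos_nonneg)
  ultimately have neg: "c * (2 + c * (norm z)\<^sup>2) * (z \<bullet> h)\<^sup>2 \<le> 0"
    by (simp add: mult_nonpos_nonneg)
  have "(norm (h + (c * (z \<bullet> h)) *\<^sub>R z))\<^sup>2 = (norm h)\<^sup>2 + c * (2 + c * (norm z)\<^sup>2) * (z \<bullet> h)\<^sup>2"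
    unfolding power2_norm_eq_inner
    by (simp add: inner_add inner_commute power2_eq_square algebra_simps)
  with neg have "(norm (h + (c * (z \<bullet> h)) *\<^sub>R z))\<^sup>2 \<le> (norm h)\<^sup>2" by linarith
  then have "norm (h + (c * (z \<bullet> h)) *\<^sub>R z) \<le> norm h" by (rule power2_le_imp_le) simp
  then show ?thesis by (simp add: smooth_stretch_deriv_def c_def mult_left_mono)
qed

text \<open>The exponent is nonpositive, so \<epsilon> only shrinks the weight. This gives a
  majorant independent of \<epsilon> for dominated convergence.\<close>

lemma smooth_stretch_weight_le:
  assumes "0 \<le> \<epsilon>" "a \<le> 1" "z \<noteq> 0"
  shows "((norm z)\<^sup>2 + \<epsilon>) powr ((a - 1) / 2) \<le> norm z powr (a - 1)"
proof -
  have "((norm z)\<^sup>2 + \<epsilon>) powr ((a - 1) / 2) \<le> ((norm z)\<^sup>2) powr ((a - 1) / 2)"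
    using assms by (intro powr_mono2') auto
  then show ?thesis by (simp add: norm_sq_powr_half)
qed

lemma smooth_stretch_measurable [measurable]:
  "smooth_stretch a \<epsilon> \<in> borel_measurable borel"
  "(\<lambda>z. smooth_stretch_deriv a \<epsilon> z h) \<in> borel_measurable borel"
  unfolding smooth_stretch_def [abs_def] smooth_stretch_deriv_def by measurable

section \<open>The weak differential of the stretch\<close>

lemma test_functionD:
  assumes "test_function \<phi>"
  shows "\<phi> differentiable_on UNIV" "continuous_on UNIV (\<lambda>x. frechet_derivative \<phi> (at x) e)"
    and "\<exists>R>0. \<forall>x. R < norm x \<longrightarrow> \<phi> x = 0 \<and> frechet_derivative \<phi> (at x) e = 0"
proof -
  have "times_cont_diff (Suc 0) \<phi>" using assms unfolding test_function_def by blast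
  then show diff: "\<phi> differentiable_on UNIV" "continuous_on UNIV (\<lambda>x. frechet_derivative \<phi> (at x) e)"
    by auto
  have "bounded (closure {x. \<phi> x \<noteq> 0})"
    using assms by (simp add: test_function_def compact_imp_bounded)
  then have "bounded {x. \<phi> x \<noteq> 0}" using bounded_closure_image bounded_subset closure_subset by blast
  then obtain R where "R > 0" and R: "\<And>x. \<phi> x \<noteq> 0 \<Longrightarrow> norm x \<le> R" by (auto simp: bounded_pos)
  have "\<phi> x = 0 \<and> frechet_derivative \<phi> (at x) e = 0" if "R < norm x" for x
  proof -
    \<comment> \<open>Openness makes the function vanish near x, so its derivative at x vanishes as
      well.\<close>
    have "open {x. R < norm x}" by (intro open_Collect_less continuous_intros)
    then have "\<forall>\<^sub>F y in at x. R < norm y"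
      using that by (auto simp: eventually_at_topological)
    then have "\<forall>\<^sub>F y in at x. 0 = \<phi> y" by (rule eventually_mono) (use R not_le in metis)
    moreover have "\<phi> x = 0" using R [of x] that by fastforce
    ultimately have "(\<phi> has_derivative (\<lambda>h. 0)) (at x)"
      using has_derivative_transform_eventually [of "\<lambda>x. 0" "\<lambda>h. 0" x UNIV \<phi>] by simp
    then have "(\<lambda>h. 0) = frechet_derivative \<phi> (at x)" by (rule frechet_derivative_at)
    with \<open>\<phi> x = 0\<close> show ?thesis by metis
  qed
  with \<open>R > 0\<close> show "\<exists>R>0. \<forall>x. R < norm x \<longrightarrow> \<phi> x = 0 \<and> frechet_derivative \<phi> (at x) e = 0" by blast
qed

lemma continuous_on_smooth_stretch:
  assumes "0 < \<epsilon>"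
  shows "continuous_on UNIV (smooth_stretch a \<epsilon>)"
    and "continuous_on UNIV (\<lambda>z. smooth_stretch_deriv a \<epsilon> z e)"
proof -
  have "(norm z)\<^sup>2 + \<epsilon> \<noteq> 0" for z :: complex
    using assms zero_le_power2 [of "norm z"] by linarith
  then show "continuous_on UNIV (smooth_stretch a \<epsilon>)"
    "continuous_on UNIV (\<lambda>z. smooth_stretch_deriv a \<epsilon> z e)"
    unfolding smooth_stretch_def [abs_def] smooth_stretch_deriv_def
    by (auto intro!: continuous_intros)
qed

text \<open>The differential of the stretch is unbounded at the origin when a < 1, so the vanishing
  of integrals of derivatives is applied to \<phi> times the smoothed stretch. As \<epsilon> tends
  to 0, both terms of the product rule are dominated by multiples of
  \<open>norm z powr (a - 1)\<close> on a disc, integrable because a - 1 > -2.\<close>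

lemma stretch_integration_by_parts:
  assumes a: "0 < a" "a \<le> 1" and \<phi>: "test_function \<phi>" and e: "e \<in> Basis"
  shows "(LINT z|lborel. frechet_derivative \<phi> (at z) e *\<^sub>R stretch a z) =
    - (LINT z|lborel. \<phi> z *\<^sub>R smooth_stretch_deriv a 0 z e)"
proof -
  define \<phi>' where "\<phi>' z = frechet_derivative \<phi> (at z) e" for z
  obtain R where "R > 0" and R: "\<And>z. R < norm z \<Longrightarrow> \<phi> z = 0 \<and> \<phi>' z = 0"
    using test_functionD(3) [OF \<phi>] unfolding \<phi>'_def by blast
  have cont': "continuous_on UNIV \<phi>'" unfolding \<phi>'_def by (rule test_functionD [OF \<phi>])
  have diff: "\<phi> differentiable (at z)" for z
    using test_functionD(1) [OF \<phi>] by (simp add: differentiable_on_def)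
  then have cont: "continuous_on UNIV \<phi>"
    by (meson differentiable_imp_continuous_within continuous_at_imp_continuous_on)
  have [measurable]: "\<phi> \<in> borel_measurable borel" "\<phi>' \<in> borel_measurable borel"
    using cont cont' by (auto intro: borel_measurable_continuous_onI)
  have bd: "\<exists>M. \<forall>z. norm z \<le> R \<longrightarrow> \<bar>f z\<bar> \<le> M" if "continuous_on UNIV f" for f :: "complex \<Rightarrow> real"
  proof -
    have "compact (f ` cball 0 R)"
      by (intro compact_continuous_image continuous_on_subset [OF that]) auto
    then show ?thesis using compact_imp_bounded by (force simp: bounded_iff)
  qed
  obtain M M' where M: "\<And>z. norm z \<le> R \<Longrightarrow> \<bar>\<phi> z\<bar> \<le> M" "\<And>z. norm z \<le> R \<Longrightarrow> \<bar>\<phi>' z\<bar> \<le> M'"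
    using bd [OF cont] bd [OF cont'] by blast
  have "M \<ge> 0" "M' \<ge> 0" using M [of 0] \<open>R > 0\<close> by auto
  define w where "w z = indicator (cball 0 R) z * norm z powr (a - 1)" for z :: complex
  have w: "integrable lborel w"
    unfolding w_def using a by (intro integrable_norm_powr_on_cball) auto
  have bound: "norm (\<phi>' z *\<^sub>R smooth_stretch a \<epsilon> z) \<le> (M' * R) * w z"
    "norm (\<phi> z *\<^sub>R smooth_stretch_deriv a \<epsilon> z e) \<le> M * w z"
    if "z \<noteq> 0" "0 \<le> \<epsilon>" for z \<epsilon>
  proof -
    note W = smooth_stretch_weight_le [OF \<open>0 \<le> \<epsilon>\<close> a(2) \<open>z \<noteq> 0\<close>]
    have s: "norm (smooth_stretch a \<epsilon> z) \<le> norm z powr (a - 1) * norm z"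
      using W by (simp add: smooth_stretch_def mult_right_mono)
    have d: "norm (smooth_stretch_deriv a \<epsilon> z e) \<le> norm z powr (a - 1)"
      using norm_smooth_stretch_deriv_le [OF \<open>0 \<le> \<epsilon>\<close> a, of z e] W e by simp
    show "norm (\<phi>' z *\<^sub>R smooth_stretch a \<epsilon> z) \<le> (M' * R) * w z"
    proof (cases "norm z \<le> R")
      case True
      have "norm (\<phi>' z *\<^sub>R smooth_stretch a \<epsilon> z) \<le> M' * (norm z powr (a - 1) * R)"
        unfolding norm_scaleR using M(2) [OF True] s True \<open>M' \<ge> 0\<close>
        by (intro mult_mono order_trans [OF s] mult_left_mono) auto
      then show ?thesis using True by (simp add: w_def mult_ac)
    qed (use R [of z] in \<open>simp add: w_def\<close>)
    show "norm (\<phi> z *\<^sub>R smooth_stretch_deriv a \<epsilon> z e) \<le> M * w z"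
    proof (cases "norm z \<le> R")
      case True
      have "norm (\<phi> z *\<^sub>R smooth_stretch_deriv a \<epsilon> z e) \<le> M * norm z powr (a - 1)"
        unfolding norm_scaleR using M(1) [OF True] d \<open>M \<ge> 0\<close> by (intro mult_mono) auto
      then show ?thesis using True by (simp add: w_def)
    qed (use R [of z] in \<open>simp add: w_def\<close>)
  qed
  \<comment> \<open>The bounds can fail at the origin for \<epsilon> > 0, because
    \<open>0 powr (a - 1)\<close> is 0 there.\<close>
  have ne: "AE z in lborel. z \<noteq> (0::complex)" by (rule AE_lborel_singleton)
  have int: "integrable lborel (\<lambda>z. \<phi>' z *\<^sub>R stretch a z)"
    "integrable lborel (\<lambda>z. \<phi> z *\<^sub>R smooth_stretch_deriv a 0 z e)"
  proof -
    have "integrable lborel (\<lambda>z. \<phi>' z *\<^sub>R smooth_stretch a 0 z)"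
    proof (rule Bochner_Integration.integrable_bound [OF integrable_mult_right [OF w, of "M' * R"]])
      show "AE z in lborel. norm (\<phi>' z *\<^sub>R smooth_stretch a 0 z) \<le> norm (M' * R * w z)"
        using ne
      proof eventually_elim
        case (elim z)
        show ?case by (rule order_trans [OF bound(1) [OF elim order_refl]]) simp
      qed
    qed simp
    then show "integrable lborel (\<lambda>z. \<phi>' z *\<^sub>R stretch a z)" by (simp add: smooth_stretch_0)
    show "integrable lborel (\<lambda>z. \<phi> z *\<^sub>R smooth_stretch_deriv a 0 z e)"
    proof (rule Bochner_Integration.integrable_bound [OF integrable_mult_right [OF w, of "M"]])
      show "AE z in lborel. norm (\<phi> z *\<^sub>R smooth_stretch_deriv a 0 z e) \<le> norm (M * w z)"
        using ne
      proof eventually_elim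
        case (elim z)
        show ?case by (rule order_trans [OF bound(2) [OF elim order_refl]]) simp
      qed
    qed simp
  qed
  \<comment> \<open>The product-rule derivative of \<phi> times the smoothed stretch in direction
    \<open>e\<close>; its integral is 0 for \<epsilon> > 0, and the case \<epsilon> = 0 is the
    claim.\<close>
  define g where "g \<epsilon> z = \<phi> z *\<^sub>R smooth_stretch_deriv a \<epsilon> z e + \<phi>' z *\<^sub>R smooth_stretch a \<epsilon> z" for \<epsilon> z
  define h where "h n = 1 / real (Suc n)" for n
  have h: "0 < h n" for n by (simp add: h_def)
  have "h \<longlonglongrightarrow> 0" unfolding h_def by (rule LIMSEQ_Suc) (rule lim_1_over_n)
  have zero: "(LINT z|lborel. g \<epsilon> z) = 0" if "0 < \<epsilon>" for \<epsilon>
    unfolding g_def \<phi>'_def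
  proof (rule integral_directional_derivative_eq_0 [where F = "\<lambda>z. \<phi> z *\<^sub>R smooth_stretch a \<epsilon> z"
        and F' = "\<lambda>z h. \<phi> z *\<^sub>R smooth_stretch_deriv a \<epsilon> z h + frechet_derivative \<phi> (at z) h *\<^sub>R smooth_stretch a \<epsilon> z"
        and R = R])
    show "((\<lambda>z. \<phi> z *\<^sub>R smooth_stretch a \<epsilon> z) has_derivative
        (\<lambda>h. \<phi> z *\<^sub>R smooth_stretch_deriv a \<epsilon> z h + frechet_derivative \<phi> (at z) h *\<^sub>R smooth_stretch a \<epsilon> z)) (at z)" for z
      using diff frechet_derivative_works
      by (intro has_derivative_scaleR smooth_stretch_has_derivative that) blast
    show "continuous_on UNIV (\<lambda>z. \<phi> z *\<^sub>R smooth_stretch_deriv a \<epsilon> z e +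
        frechet_derivative \<phi> (at z) e *\<^sub>R smooth_stretch a \<epsilon> z)"
      using cont cont' that unfolding \<phi>'_def
      by (intro continuous_on_add continuous_on_scaleR continuous_on_smooth_stretch)
  qed (use R in simp)
  have "(\<lambda>n. LINT z|lborel. g (h n) z) \<longlonglongrightarrow> (LINT z|lborel. g 0 z)"
  proof (rule integral_dominated_convergence [where w = "\<lambda>z. (M + M' * R) * w z"])
    show "integrable lborel (\<lambda>z. (M + M' * R) * w z)" using w by simp
    show "AE z in lborel. norm (g (h n) z) \<le> (M + M' * R) * w z" for n
      using ne
    proof eventually_elim
      case (elim z)
      show ?case using norm_triangle_mono [OF bound(2,1) [OF elim less_imp_le [OF h [of n]]]]
        by (simp add: g_def algebra_simps)
    qed
    show "AE z in lborel. (\<lambda>n. g (h n) z) \<longlonglongrightarrow> g 0 z"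
      using ne
    proof eventually_elim
      case (elim z)
      then show ?case unfolding g_def smooth_stretch_def smooth_stretch_deriv_def
        using \<open>h \<longlonglongrightarrow> 0\<close> by (intro tendsto_intros) auto
    qed
  qed (simp_all add: g_def)
  then have "(LINT z|lborel. g 0 z) = 0"
    using zero [OF h] by (simp add: LIMSEQ_const_iff)
  moreover have "(LINT z|lborel. g 0 z) = (LINT z|lborel. \<phi> z *\<^sub>R smooth_stretch_deriv a 0 z e) +
      (LINT z|lborel. \<phi>' z *\<^sub>R stretch a z)"
    unfolding g_def smooth_stretch_0 using int by simp
  ultimately show ?thesis unfolding \<phi>'_def by (simp add: eq_neg_iff_add_eq_0 add.commute)
qed

section \<open>Homeomorphism, square integrability and distortion\<close>

lemma continuous_on_stretch:
  assumes "0 < a"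
  shows "continuous_on UNIV (stretch a)"
proof (rule continuous_at_imp_continuous_on, rule ballI)
  fix z :: complex
  show "isCont (stretch a) z"
  proof (cases "z = 0")
    case True
    have "((\<lambda>z::complex. norm z powr a) \<longlongrightarrow> 0 powr a) (at 0)"
      using assms by (intro tendsto_powr' tendsto_const tendsto_norm_zero tendsto_ident_at) auto
    then have "((\<lambda>z. norm (stretch a z)) \<longlongrightarrow> 0) (at 0)" by (simp add: norm_stretch)
    then show ?thesis using True by (simp add: isCont_def tendsto_norm_zero_iff)
  next
    case False
    then show ?thesis unfolding stretch_def [abs_def] by (intro continuous_intros) auto
  qed
qed

lemma homeomorphism_stretch:
  assumes "0 < a"
  shows "homeomorphism UNIV UNIV (stretch a) (stretch (1 / a))"
proof (rule homeomorphismI)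
  show "continuous_on UNIV (stretch a)" "continuous_on UNIV (stretch (1 / a))"
    using assms by (auto intro: continuous_on_stretch)
qed (use assms in \<open>auto simp: stretch_stretch\<close>)

lemma L2_locI_borel:
  assumes [measurable]: "f \<in> borel_measurable borel"
    and int: "\<And>S. compact S \<Longrightarrow> integrable lborel (\<lambda>x. indicator S x *\<^sub>R (norm (f x))\<^sup>2)"
  shows "L2_loc f"
  unfolding L2_loc_def
proof (intro conjI allI impI)
  show "f \<in> borel_measurable lebesgue" by (intro measurable_completion) simp
  fix S :: "'a set" assume "compact S"
  then have [measurable]: "S \<in> sets borel" by (intro borel_compact)
  show "set_integrable lebesgue S (\<lambda>x. (norm (f x))\<^sup>2)"
    unfolding set_integrable_def using int [OF \<open>compact S\<close>]
    by (subst integrable_completion) auto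
qed

text \<open>With W = \<open>norm z powr (a - 1)\<close>, the differential scales by W tangentially
  and by aW radially. Its norm is at most W and its determinant is a W^2, so the distortion
  inequality holds with K = 1/a.\<close>

lemma quasiconformal_stretch:
  assumes a: "0 < a" "a \<le> 1" and K: "K * a = 1"
  shows "quasiconformal K (stretch a)"
  unfolding quasiconformal_def
proof
  show "\<exists>h. homeomorphism UNIV UNIV (stretch a) h" using homeomorphism_stretch [OF a(1)] by blast
  define D where "D z = Blinfun (smooth_stretch_deriv a 0 z)" for z
  have D: "blinfun_apply (D z) = smooth_stretch_deriv a 0 z" for z
  proof -
    have "bounded_linear (smooth_stretch_deriv a 0 z)"
    proof (rule bounded_linear_intro)
      show "norm (smooth_stretch_deriv a 0 z h) \<le> norm h * ((norm z)\<^sup>2 + 0) powr ((a - 1) / 2)" for h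
        using norm_smooth_stretch_deriv_le [of 0 a z h] a by (simp add: mult.commute)
    qed (simp_all add: smooth_stretch_deriv_def inner_add_right distrib_left add_divide_distrib
          scaleR_add_left scaleR_add_right mult_ac)
    then show ?thesis by (simp add: D_def bounded_linear_Blinfun_apply)
  qed
  have norm_D: "norm (blinfun_apply (D z) h) \<le> norm z powr (a - 1) * norm h" for z h
    using norm_smooth_stretch_deriv_le [of 0 a z h] a by (simp add: D norm_sq_powr_half)
  show "\<exists>D. W12_loc_with_differential (stretch a) D \<and>
      (AE x in lebesgue. (norm (D x))\<^sup>2 \<le> K * det_real_linear (D x))"
  proof (intro exI [of _ D] conjI)
    have "stretch a \<in> borel_measurable borel"
      using smooth_stretch_measurable(1) [of a 0] by (simp add: smooth_stretch_0)
    note [measurable] = this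
    have "L2_loc (stretch a)"
    proof (rule L2_locI_borel)
      fix S :: "complex set" assume "compact S"
      then show "integrable lborel (\<lambda>x. indicator S x *\<^sub>R (norm (stretch a x))\<^sup>2)"
        using continuous_on_subset [OF continuous_on_stretch [OF a(1)], of S]
        by (intro borel_integrable_compact continuous_intros) auto
    qed simp
    moreover have "L2_loc (\<lambda>x. blinfun_apply (D x) e)" if e: "e \<in> Basis" for e
    proof (rule L2_locI_borel)
      show [measurable]: "(\<lambda>x. blinfun_apply (D x) e) \<in> borel_measurable borel" unfolding D by simp
      fix S :: "complex set" assume "compact S"
      then have [measurable]: "S \<in> sets borel" by (intro borel_compact)
      obtain R where R: "\<And>z. z \<in> S \<Longrightarrow> norm z \<le> R"
        using compact_imp_bounded [OF \<open>compact S\<close>] by (auto simp: bounded_iff)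
      \<comment> \<open>Squaring doubles the exponent: \<open>2 * (a - 1)\<close> exceeds -2 exactly
        because a > 0.\<close>
      have "integrable lborel (\<lambda>z::complex. indicator (cball 0 R) z * norm z powr (2 * (a - 1)))"
        using a by (intro integrable_norm_powr_on_cball) auto
      then show "integrable lborel (\<lambda>x. indicator S x *\<^sub>R (norm (blinfun_apply (D x) e))\<^sup>2)"
      proof (rule Bochner_Integration.integrable_bound)
        have "(norm (blinfun_apply (D z) e))\<^sup>2 \<le> norm z powr (2 * (a - 1))" for z
        proof -
          have "(norm (blinfun_apply (D z) e))\<^sup>2 \<le> (norm z powr (a - 1))\<^sup>2"
            using norm_D [of z e] e by (intro power_mono) auto
          then show ?thesis by (cases "z = 0") (auto simp: powr_power)
        qed
        then show "AE z in lborel. norm (indicator S z *\<^sub>R (norm (blinfun_apply (D z) e))\<^sup>2)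
            \<le> norm (indicator (cball 0 R) z * norm z powr (2 * (a - 1)))"
          using R by (intro always_eventually allI) (auto split: split_indicator)
      qed measurable
    qed
    moreover have "(LINT x|lebesgue. frechet_derivative \<phi> (at x) e *\<^sub>R stretch a x) =
        - (LINT x|lebesgue. \<phi> x *\<^sub>R blinfun_apply (D x) e)"
      if e: "e \<in> Basis" and \<phi>: "test_function \<phi>" for e \<phi>
    proof -
      have [measurable]: "(\<lambda>x. frechet_derivative \<phi> (at x) e) \<in> borel_measurable borel"
        by (intro borel_measurable_continuous_onI test_functionD [OF \<phi>])
      have "continuous_on UNIV \<phi>"
        using test_functionD(1) [OF \<phi>] by (rule differentiable_imp_continuous_on)
      then have [measurable]: "\<phi> \<in> borel_measurable borel" by (rule borel_measurable_continuous_onI)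
      show ?thesis unfolding D using stretch_integration_by_parts [OF a \<phi> e]
        by (simp add: integral_completion)
    qed
    ultimately show "W12_loc_with_differential (stretch a) D"
      unfolding W12_loc_with_differential_def by blast
    have "(norm (D z))\<^sup>2 \<le> K * det_real_linear (D z)" if "z \<noteq> 0" for z
    proof -
      define W where "W = norm z powr (a - 1)"
      define c where "c = (a - 1) / (norm z)\<^sup>2"
      have "norm (D z) \<le> W" unfolding W_def by (intro norm_blinfun_bound norm_D) auto
      then have "(norm (D z))\<^sup>2 \<le> W\<^sup>2" by (intro power_mono) auto
      also have "W\<^sup>2 = K * det_real_linear (D z)"
      proof -
        have D_eq: "blinfun_apply (D z) h = W *\<^sub>R (h + (c * (z \<bullet> h)) *\<^sub>R z)" for h
          by (simp add: D smooth_stretch_deriv_def norm_sq_powr_half W_def c_def)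
        \<comment> \<open>The identity plus the rank-one map sending h to c (z . h) z has
          determinant 1 + c |z|^2.\<close>
        have "det_real_linear (D z) = W\<^sup>2 * (1 + c * ((Re z)\<^sup>2 + (Im z)\<^sup>2))"
          by (simp add: det_real_linear_def det_2 D_eq inner_complex_def power2_eq_square algebra_simps)
        also have "(Re z)\<^sup>2 + (Im z)\<^sup>2 = (norm z)\<^sup>2" by (simp add: cmod_power2)
        also have "1 + c * (norm z)\<^sup>2 = a" using that by (simp add: c_def)
        finally show ?thesis using K by (simp add: mult_ac)
      qed
      finally show ?thesis .
    qed
    moreover have "AE z in lebesgue. z \<noteq> (0::complex)"
      by (intro AE_completion AE_lborel_singleton)
    ultimately show "AE z in lebesgue. (norm (D z))\<^sup>2 \<le> K * det_real_linear (D z)"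
      by (auto elim: eventually_mono)
  qed
qed

theorem theorem7p1:
  fixes K :: real
  assumes "K \<ge> 1"
  shows "\<exists>(E :: complex set) (g :: complex \<Rightarrow> complex).
           compact E \<and> hausdorff_dim E = 0 \<and> quasiconformal K g \<and>
           (\<forall>\<theta>. 0 < \<theta> \<and> \<theta> \<le> 1 \<longrightarrow>
              0 < upper_intermediate_dim \<theta> E \<and> 0 < upper_intermediate_dim \<theta> (g ` E) \<and>
              1 / upper_intermediate_dim \<theta> (g ` E) - 1 / 2 =
              (1 / K) * (1 / upper_intermediate_dim \<theta> E - 1 / 2))"
proof -
  \<comment> \<open>Any positive exponent would serve here; only the ratio between the exponents of
    the image and of \<open>E\<close> enters the identity.\<close>
  define E where "E = stretched_lattice 1"
  define a where "a = 1 / K"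
  have a: "0 < a" "a \<le> 1" "K * a = 1" using assms by (auto simp: a_def)
  have gE: "stretch a ` E = stretched_lattice a"
    by (simp add: E_def stretch_image_stretched_lattice)
  have dim: "0 < upper_intermediate_dim \<theta> E \<and> 0 < upper_intermediate_dim \<theta> (stretch a ` E) \<and>
      1 / upper_intermediate_dim \<theta> (stretch a ` E) - 1 / 2 =
      (1 / K) * (1 / upper_intermediate_dim \<theta> E - 1 / 2)" if \<theta>: "0 < \<theta>" "\<theta> \<le> 1" for \<theta>
  proof -
    have half: "1 / (2 * \<theta> / (p + \<theta>)) - 1 / 2 = p / (2 * \<theta>)" if "0 < p" for p :: real
      using that \<theta> by (simp add: field_simps)
    show ?thesis
      unfolding gE unfolding E_def intermediate_dim_stretched_lattice [OF zero_less_one \<theta>]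
        intermediate_dim_stretched_lattice [OF a(1) \<theta>] half [OF zero_less_one] half [OF a(1)]
      using a(1) \<theta> add_pos_pos [OF a(1) \<theta>(1)] by (simp add: a_def)
  qed
  show ?thesis
  proof (intro exI conjI allI impI)
    show "compact E" by (simp add: E_def compact_stretched_lattice)
    show "hausdorff_dim E = 0"
      by (simp add: E_def hausdorff_dim_countable countable_stretched_lattice)
    show "quasiconformal K (stretch a)" using a by (rule quasiconformal_stretch)
  qed (use dim in blast)+
qed

end
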